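(* Let $d\ge 1$, let $1\le q<\infty$, and let $w$ be a discrete $A_q$-weight on $\mathbb{Z}^d$. Then the class $\mathcal{B}(\mathbb{Z}^d,\mathbb{Z}^d)$ of infinite matrices is a unital Banach algebra under matrix multiplication, and also a subalgebra of $\mathcal{B}(\ell^q_w)$, the algebra of all bounded linear operators on the weighted sequence space $\ell^q_w$.
   Context: For $x=(x_1,\dots,x_d)\in\mathbb{R}^d$ put $|x|_\infty=\max(|x_1|,\dots,|x_d|)$. $\mathcal{B}(\mathbb{Z}^d,\mathbb{Z}^d)$ is the set of all complex infinite matrices $A=(a(i,j))_{i,j\in\mathbb{Z}^d}$ with $$\|A\|_{\mathcal{B}}:=\sum_{k\in\mathbb{Z}^d}\Big(\sup_{|i-j|_\infty\ge|k|_\infty}|a(i,j)|\Big)<\infty .$$ "Unital Banach algebra" is understood in the sense that the identity matrix belongs to the class, the class is complete, and there is a constant $C$ with $\|AB\|_{\mathcal{B}}\le C\|A\|_{\mathcal{B}}\|B\|_{\mathcal{B}}$ for all $A,B$ in the class, so that the equivalent norm $\|A\|'_{\mathcal{B}}:=\sup_{\|B\|_{\mathcal{B}}=1}\|AB\|_{\mathcal{B}}$ satisfies $\|AB\|'_{\mathcal B}\le\|A\|'_{\mathcal B}\|B\|'_{\mathcal B}$ and makes the class a unital Banach algebra. A positive sequence $w=(w(i))_{i\in\mathbb{Z}^d}$ is a discrete $A_q$-weight, for $1<q<\infty$, if there is a constant $C$ with $$\Big(N^{-d}\sum_{i\in a+[0,N-1]^d}w(i)\Big)\Big(N^{-d}\sum_{i\in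 a+[0,N-1]^d}w(i)^{-1/(q-1)}\Big)^{q-1}\le C$$ for all $a\in\mathbb{Z}^d$ and all integers $N\ge1$; it is a discrete $A_1$-weight if there is a constant $C$ with $N^{-d}\sum_{i\in a+[0,N-1]^d}w(i)\le C\inf_{i\in a+[0,N-1]^d}w(i)$ for all such $a,N$ (sums and infima over integer points). $\ell^q_w$ is the space of sequences $c=(c(i))_{i\in\mathbb{Z}^d}$ with $\|c\|_{q,w}:=(\sum_i|c(i)|^qw(i))^{1/q}<\infty$. A matrix $A$ acts on sequences by $(Ac)(i)=\sum_{j}a(i,j)c(j)$ and is identified with the corresponding operator. *)

theory Defs
  imports "HOL-Analysis.Analysis" "HOL-Algebra.Module"
begin

section \<open>Complex Banach algebras with explicit carrier\<close>

definition complex_ring :: "complex ring" where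
  "complex_ring = \<lparr>carrier = UNIV, mult = (*), one = 1, zero = 0, add = (+)\<rparr>"

text \<open>The locale \<^locale>\<open>algebra\<close> of HOL-Algebra is restricted to commutative algebras.\<close>

definition unital_algebra :: "(complex, 'a) module \<Rightarrow> bool" where
  "unital_algebra M \<longleftrightarrow>
     Ring.ring M \<and> Module.module complex_ring M \<and>
     (\<forall>\<alpha>. \<forall>x\<in>carrier M. \<forall>y\<in>carrier M.
        (\<alpha> \<odot>\<^bsub>M\<^esub> x) \<otimes>\<^bsub>M\<^esub> y = \<alpha> \<odot>\<^bsub>M\<^esub> (x \<otimes>\<^bsub>M\<^esub> y) \<and>
        x \<otimes>\<^bsub>M\<^esub> (\<alpha> \<odot>\<^bsub>M\<^esub> y) = \<alpha> \<odot>\<^bsub>M\<^esub> (x \<otimes>\<^bsub>M\<^esub> y))"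

definition is_norm :: "(complex, 'a) module \<Rightarrow> ('a \<Rightarrow> real) \<Rightarrow> bool" where
  "is_norm M \<nu> \<longleftrightarrow>
     (\<forall>x\<in>carrier M. 0 \<le> \<nu> x \<and> (\<nu> x = 0 \<longleftrightarrow> x = \<zero>\<^bsub>M\<^esub>)) \<and>
     (\<forall>\<alpha>. \<forall>x\<in>carrier M. \<nu> (\<alpha> \<odot>\<^bsub>M\<^esub> x) = cmod \<alpha> * \<nu> x) \<and>
     (\<forall>x\<in>carrier M. \<forall>y\<in>carrier M. \<nu> (x \<oplus>\<^bsub>M\<^esub> y) \<le> \<nu> x + \<nu> y)"

definition complete_norm :: "(complex, 'a) module \<Rightarrow> ('a \<Rightarrow> real) \<Rightarrow> bool" where
  "complete_norm M \<nu> \<longleftrightarrow> is_norm M \<nu> \<and>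
     (\<forall>X :: nat \<Rightarrow> 'a. range X \<subseteq> carrier M \<longrightarrow>
        (\<forall>\<epsilon>>0. \<exists>N. \<forall>m\<ge>N. \<forall>n\<ge>N. \<nu> (X m \<ominus>\<^bsub>M\<^esub> X n) < \<epsilon>) \<longrightarrow>
        (\<exists>x\<in>carrier M. (\<lambda>n. \<nu> (X n \<ominus>\<^bsub>M\<^esub> x)) \<longlonglongrightarrow> 0))"

definition unital_banach_algebra :: "(complex, 'a) module \<Rightarrow> ('a \<Rightarrow> real) \<Rightarrow> bool" where
  "unital_banach_algebra M \<nu> \<longleftrightarrow>
     unital_algebra M \<and> complete_norm M \<nu> \<and> \<nu> \<one>\<^bsub>M\<^esub> = 1 \<and>
     (\<forall>x\<in>carrier M. \<forall>y\<in>carrier M. \<nu> (x \<otimes>\<^bsub>M\<^esub> y) \<le> \<nu> x * \<nu> y)"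

definition regular_norm :: "(complex, 'a) module \<Rightarrow> ('a \<Rightarrow> real) \<Rightarrow> 'a \<Rightarrow> real" where
  "regular_norm M \<nu> x = (SUP y\<in>{y\<in>carrier M. \<nu> y = 1}. \<nu> (x \<otimes>\<^bsub>M\<^esub> y))"

definition equivalent_norms :: "(complex, 'a) module \<Rightarrow> ('a \<Rightarrow> real) \<Rightarrow> ('a \<Rightarrow> real) \<Rightarrow> bool" where
  "equivalent_norms M \<nu> \<nu>' \<longleftrightarrow>
     (\<exists>b>0. \<exists>B>0. \<forall>x\<in>carrier M. b * \<nu> x \<le> \<nu>' x \<and> \<nu>' x \<le> B * \<nu> x)"

text \<open>An injective unital homomorphism, i.e. an identification of \<open>M\<close> with a unital
  subalgebra of \<open>N\<close>.\<close>

definition algebra_embedding ::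
    "(complex, 'a) module \<Rightarrow> (complex, 'b) module \<Rightarrow> ('a \<Rightarrow> 'b) \<Rightarrow> bool" where
  "algebra_embedding M N h \<longleftrightarrow>
     unital_algebra M \<and> unital_algebra N \<and>
     h \<in> ring_hom M N \<and>
     (\<forall>\<alpha>. \<forall>x\<in>carrier M. h (\<alpha> \<odot>\<^bsub>M\<^esub> x) = \<alpha> \<odot>\<^bsub>N\<^esub> h x) \<and>
     inj_on h (carrier M)"

section \<open>The matrix class\<close>

text \<open>The lattice $\mathbb{Z}^d$ is the type \<open>int ^ 'd\<close> with $d$ = \<open>CARD('d)\<close>, so $d \ge 1$.\<close>

definition linf :: "int ^ 'd \<Rightarrow> int" where
  "linf x = Max (range (\<lambda>m. \<bar>x $ m\<bar>))"

type_synonym 'd lmatrix = "int ^ 'd \<Rightarrow> int ^ 'd \<Rightarrow> complex"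

text \<open>The norm is first formed in the extended nonnegative reals, where all suprema and sums
  exist, so that its finiteness is a genuine condition.\<close>

definition enormB :: "('d::finite) lmatrix \<Rightarrow> ennreal" where
  "enormB A = (\<Sum>\<^sub>\<infinity>k :: int ^ 'd. SUP (i, j)\<in>{(i, j). linf (i - j) \<ge> linf k}. ennreal (cmod (A i j)))"

definition normB :: "('d::finite) lmatrix \<Rightarrow> real" where
  "normB A = enn2real (enormB A)"

definition classB :: "('d::finite) lmatrix set" where
  "classB = {A. enormB A < \<infinity>}"

definition matrix_algebra :: "(complex, ('d::finite) lmatrix) module" where
  "matrix_algebra =
     \<lparr>carrier = classB,
      mult = (\<lambda>A B i j. \<Sum>\<^sub>\<infinity>l. A i l * B l j),
      one = (\<lambda>i j. if i = j then 1 else 0),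
      zero = (\<lambda>i j. 0),
      add = (\<lambda>A B i j. A i j + B i j),
      smult = (\<lambda>\<alpha> A i j. \<alpha> * A i j)\<rparr>"

section \<open>Discrete Muckenhoupt weights\<close>

definition cube :: "int ^ 'd \<Rightarrow> nat \<Rightarrow> (int ^ 'd) set" where
  "cube a N = {i. \<forall>m. a $ m \<le> i $ m \<and> i $ m \<le> a $ m + int N - 1}"

definition cube_mean :: "(int ^ 'd \<Rightarrow> real) \<Rightarrow> int ^ 'd \<Rightarrow> nat \<Rightarrow> real" where
  "cube_mean f a N = (\<Sum>i\<in>cube a N. f i) / real N ^ CARD('d)"

definition discrete_weight :: "real \<Rightarrow> (int ^ 'd \<Rightarrow> real) \<Rightarrow> bool" where
  "discrete_weight q w \<longleftrightarrow> (\<forall>i. 0 < w i) \<and>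
     (if q = 1 then
        \<exists>C. \<forall>a. \<forall>N\<ge>1. cube_mean w a N \<le> C * (INF i\<in>cube a N. w i)
      else
        \<exists>C. \<forall>a. \<forall>N\<ge>1.
          cube_mean w a N * cube_mean (\<lambda>i. w i powr (- 1 / (q - 1))) a N powr (q - 1) \<le> C)"

section \<open>Weighted sequence spaces and their bounded operators\<close>

type_synonym 'd lseq = "int ^ 'd \<Rightarrow> complex"

definition lq_space :: "real \<Rightarrow> (int ^ 'd \<Rightarrow> real) \<Rightarrow> 'd lseq set" where
  "lq_space q w = {c. (\<lambda>i. cmod (c i) powr q * w i) summable_on UNIV}"

definition lq_norm :: "real \<Rightarrow> (int ^ 'd \<Rightarrow> real) \<Rightarrow> 'd lseq \<Rightarrow> real" where
  "lq_norm q w c = (\<Sum>\<^sub>\<infinity>i. cmod (c i) powr q * w i) powr (1 / q)"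

text \<open>Operators are taken to be \<^const>\<open>undefined\<close> outside the space, so that equality of operators
  is equality of functions.\<close>

definition bounded_operators ::
    "real \<Rightarrow> (int ^ 'd \<Rightarrow> real) \<Rightarrow> ('d lseq \<Rightarrow> 'd lseq) set" where
  "bounded_operators q w =
     {T \<in> lq_space q w \<rightarrow>\<^sub>E lq_space q w.
        (\<forall>c\<in>lq_space q w. \<forall>c'\<in>lq_space q w.
           T (\<lambda>i. c i + c' i) = (\<lambda>i. T c i + T c' i)) \<and>
        (\<forall>\<alpha>. \<forall>c\<in>lq_space q w. T (\<lambda>i. \<alpha> * c i) = (\<lambda>i. \<alpha> * T c i)) \<and>
        (\<exists>K. \<forall>c\<in>lq_space q w. lq_norm q w (T c) \<le> K * lq_norm q w c)}"

definition operator_algebra ::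
    "real \<Rightarrow> (int ^ 'd \<Rightarrow> real) \<Rightarrow> (complex, 'd lseq \<Rightarrow> 'd lseq) module" where
  "operator_algebra q w =
     \<lparr>carrier = bounded_operators q w,
      mult = compose (lq_space q w),
      one = (\<lambda>c\<in>lq_space q w. c),
      zero = (\<lambda>c\<in>lq_space q w. \<lambda>i. 0),
      add = (\<lambda>S T. \<lambda>c\<in>lq_space q w. \<lambda>i. S c i + T c i),
      smult = (\<lambda>\<alpha> T. \<lambda>c\<in>lq_space q w. \<lambda>i. \<alpha> * T c i)\<rparr>"

definition matrix_operator ::
    "real \<Rightarrow> (int ^ 'd \<Rightarrow> real) \<Rightarrow> 'd lmatrix \<Rightarrow> 'd lseq \<Rightarrow> 'd lseq" where
  "matrix_operator q w A = (\<lambda>c\<in>lq_space q w. \<lambda>i. \<Sum>\<^sub>\<infinity>j. A i j * c j)"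

end

theory Submission
  imports Defs
begin

text \<open>
  Let \<open>a(m)\<close> be the supremum of \<open>\<bar>A(i,j)\<bar>\<close> over \<open>\<bar>i - j\<bar> \<ge> m\<close>, so that the norm of \<open>A\<close> is the sum of the
  radially decreasing kernel \<open>a(\<bar>k\<bar>)\<close>. In \<open>(AB)(i,j)\<close> each intermediate index \<open>l\<close> is at distance at
  least \<open>h = \<lceil>\<bar>i - j\<bar>/2\<rceil>\<close> from \<open>i\<close> or from \<open>j\<close>, which gives the majorant \<open>a(h) \<parallel>B\<parallel> + b(h) \<parallel>A\<parallel>\<close>;
  halving the coordinates of \<open>k\<close> is \<open>2\<^sup>d\<close>-to-one, so this majorant is again summable.

  For the action on the weighted space no maximal function is needed. The kernel \<open>a(\<bar>i - j\<bar>)\<close> is a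
  positive combination of indicators of balls \<open>\<bar>i - j\<bar> \<le> n\<close>, and the corresponding averaging operators
  are bounded uniformly in \<open>n\<close>: by Hoelder's inequality with the dual weight \<open>\<sigma> = w\<^bsup>-1/(q-1)\<^esup>\<close>, and
  because the ball of radius \<open>n\<close> about \<open>i\<close> lies in the ball of radius \<open>2n\<close> about each of its points,
  their norms are controlled by the \<open>A\<^sub>q\<close> constant of the latter ball. Jensen's inequality then sums
  the averages.
\<close>

section \<open>The lattice\<close>

lemma linf_le_iff: "linf x \<le> n \<longleftrightarrow> (\<forall>m. \<bar>x $ m\<bar> \<le> n)" for x :: "int ^ 'd::finite"
  by (auto simp: linf_def)

lemma abs_nth_le_linf: "\<bar>x $ m\<bar> \<le> linf x" for x :: "int ^ 'd::finite"
  using linf_le_iff[of x "linf x"] by simp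

lemma linf_nonneg: "0 \<le> linf x" for x :: "int ^ 'd::finite"
  using abs_nth_le_linf[of x undefined] by linarith

lemma linf_zero [simp]: "linf (0 :: int ^ 'd::finite) = 0"
  by (intro antisym linf_nonneg) (simp add: linf_le_iff)

lemma linf_eq_0_iff [simp]: "linf x = 0 \<longleftrightarrow> x = 0" for x :: "int ^ 'd::finite"
  by (metis abs_nth_le_linf abs_le_zero_iff linf_zero vec_eq_iff zero_index)

lemma linf_minus [simp]: "linf (- x) = linf x" for x :: "int ^ 'd::finite"
  by (simp add: linf_def)

lemma linf_minus_commute: "linf (x - y) = linf (y - x)" for x :: "int ^ 'd::finite"
  by (metis linf_minus minus_diff_eq)

lemma linf_triangle: "linf (x + y) \<le> linf x + linf y" for x :: "int ^ 'd::finite"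
  unfolding linf_le_iff
  by (metis abs_nth_le_linf abs_triangle_ineq add_mono order_trans vector_add_component)

lemma linf_diff_triangle: "linf (i - j) \<le> linf (i - l) + linf (l - j)"
  for i :: "int ^ 'd::finite"
  using linf_triangle[of "i - l" "l - j"] by simp

section \<open>Cubes and balls for the maximum norm\<close>

text \<open>A cube is a product of integer intervals with \<open>N\<close> points each; finiteness
  and cardinality are then those of \<open>Pi\<^sub>E\<close>.\<close>

lemma bij_betw_vec_lambda_cube:
  "bij_betw vec_lambda (Pi\<^sub>E UNIV (\<lambda>m. {a $ m .. a $ m + int N - 1})) (cube a N)"
  for a :: "int ^ 'd::finite"
  by (rule bij_betw_byWitness[where f' = vec_nth]) (auto simp: cube_def PiE_iff)

lemma finite_cube [simp]: "finite (cube a N)" for a :: "int ^ 'd::finite"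
  using bij_betw_finite[OF bij_betw_vec_lambda_cube[of a N]] by (simp add: finite_PiE)

lemma card_cube: "card (cube a N) = N ^ CARD('d)" for a :: "int ^ 'd::finite"
  using bij_betw_same_card[OF bij_betw_vec_lambda_cube[of a N]] by (simp add: card_PiE)

text \<open>Links the kernel estimates, which use centred balls, to the weight condition, which uses
  cubes given by a corner. Both endpoints and the centre count, so a side has
  \<open>2 * n + 1\<close> points.\<close>

lemma linf_ball_eq_cube: "{j. linf (i - j) \<le> int n} = cube (i - (\<chi> m. int n)) (2 * n + 1)"
  for i :: "int ^ 'd::finite"
proof -
  have "\<bar>x - y\<bar> \<le> int n \<longleftrightarrow> x - int n \<le> y \<and> y \<le> x - int n + int (2 * n + 1) - 1"
    for x y :: int by linarith
  then show ?thesis by (simp add: cube_def linf_le_iff)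
qed

lemma finite_linf_ball: "finite {j. linf (i - j) \<le> n}" for i :: "int ^ 'd::finite"
  by (rule finite_subset[of _ "{j. linf (i - j) \<le> int (nat n)}"])
     (force, simp only: linf_ball_eq_cube finite_cube)

lemma card_linf_ball: "card {j. linf (i - j) \<le> int n} = (2 * n + 1) ^ CARD('d)"
  for i :: "int ^ 'd::finite"
  by (simp only: linf_ball_eq_cube card_cube)

text \<open>Rows and columns of a convolution kernel are reflections and translates of one sequence
  on the lattice, so they all have the same total.\<close>

lemma has_sum_translate_reflect:
  "((\<lambda>l. f (i - l)) has_sum s) UNIV \<longleftrightarrow> (f has_sum s) UNIV"
  for f :: "'a::ab_group_add \<Rightarrow> 'b::{comm_monoid_add,topological_space}"
  by (rule has_sum_reindex_bij_betw, rule bij_betw_byWitness[where f' = "\<lambda>l. i - l"]) auto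

lemma has_sum_translate:
  "((\<lambda>l. f (l - i)) has_sum s) UNIV \<longleftrightarrow> (f has_sum s) UNIV"
  for f :: "'a::ab_group_add \<Rightarrow> 'b::{comm_monoid_add,topological_space}"
  by (rule has_sum_reindex_bij_betw, rule bij_betw_byWitness[where f' = "\<lambda>l. l + i"]) auto

section \<open>Radial majorants\<close>

lemma sum_le_infsum_ennreal: "finite F \<Longrightarrow> sum f F \<le> (\<Sum>\<^sub>\<infinity>x. f x)"
  for f :: "'a \<Rightarrow> ennreal"
  by (subst nonneg_infsum_complete) (auto intro: SUP_upper)

text \<open>The decreasing radial majorant of the entries. It stays in \<open>ennreal\<close>
  because for a general matrix the supremum may be infinite.\<close>

definition etail :: "('d::finite) lmatrix \<Rightarrow> int \<Rightarrow> ennreal" where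
  "etail A m = (SUP (i, j)\<in>{(i, j). linf (i - j) \<ge> m}. ennreal (cmod (A i j)))"

text \<open>Informative only where \<open>etail\<close> is finite, since \<open>enn2real\<close>
  sends infinity to 0; the facts relating it to the entries are therefore confined to
  \<open>classB\<close>.\<close>

definition tail :: "('d::finite) lmatrix \<Rightarrow> int \<Rightarrow> real" where
  "tail A m = enn2real (etail A m)"

lemma tail_nonneg: "0 \<le> tail A m"
  by (simp add: tail_def)

lemma normB_nonneg: "0 \<le> normB A"
  by (simp add: normB_def)

lemma enormB_etail: "enormB A = (\<Sum>\<^sub>\<infinity>k :: int ^ 'd. etail A (linf k))"
  for A :: "('d::finite) lmatrix"
  by (simp add: enormB_def etail_def)

lemma etail_le_iff: "etail A m \<le> e \<longleftrightarrow> (\<forall>i j. m \<le> linf (i - j) \<longrightarrow> ennreal (cmod (A i j)) \<le> e)"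
  by (auto simp: etail_def SUP_le_iff)

lemma entry_le_etail: "m \<le> linf (i - j) \<Longrightarrow> ennreal (cmod (A i j)) \<le> etail A m"
  using etail_le_iff by blast

lemma etail_antimono: "m \<le> n \<Longrightarrow> etail A n \<le> etail A m"
  by (subst etail_le_iff) (auto intro: entry_le_etail)

text \<open>The single summand at \<open>k = 0\<close> is the supremum over all entries and so
  dominates every tail.\<close>

lemma etail_le_enormB: "etail A m \<le> enormB A" for A :: "('d::finite) lmatrix"
proof -
  have "etail A m \<le> (\<Sum>k\<in>{0 :: int ^ 'd}. etail A (linf k))"
    using linf_nonneg by (auto simp: etail_le_iff intro: entry_le_etail)
  also have "\<dots> \<le> enormB A"
    unfolding enormB_etail by (rule sum_le_infsum_ennreal) simp
  finally show ?thesis .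
qed

context
  fixes A :: "('d::finite) lmatrix" assumes A: "A \<in> classB"
begin

lemma ennreal_tail: "ennreal (tail A m) = etail A m"
proof -
  have "etail A m < \<infinity>"
    using A etail_le_enormB[of A m] by (auto simp: classB_def elim: le_less_trans)
  then show ?thesis by (simp add: tail_def)
qed

lemma ennreal_normB: "ennreal (normB A) = enormB A"
  using A by (simp add: normB_def classB_def)

lemma entry_le_tail: "m \<le> linf (i - j) \<Longrightarrow> cmod (A i j) \<le> tail A m"
  using entry_le_etail[of m i j A] by (simp add: ennreal_tail[symmetric] tail_nonneg)

text \<open>Moves the norm from \<open>ennreal\<close> to a convergent real sum. Finite partial sums
  are bounded by the norm, which gives summability and one inequality; the other follows because the
  \<open>ennreal\<close> sum is the supremum of the same partial sums.\<close>

lemma tail_has_sum: "((\<lambda>k. tail A (linf k)) has_sum normB A) (UNIV :: (int ^ 'd) set)"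
proof -
  have *: "(\<Sum>k\<in>F. tail A (linf k)) \<le> normB A" if "finite F" for F :: "(int ^ 'd) set"
  proof -
    have "ennreal (\<Sum>k\<in>F. tail A (linf k)) = (\<Sum>k\<in>F. etail A (linf k))"
      by (subst sum_ennreal[symmetric]) (auto simp: ennreal_tail tail_nonneg)
    also have "\<dots> \<le> enormB A"
      unfolding enormB_etail using that by (rule sum_le_infsum_ennreal)
    finally show ?thesis by (simp add: ennreal_normB[symmetric] normB_nonneg)
  qed
  have s: "(\<lambda>k. tail A (linf k)) summable_on (UNIV :: (int ^ 'd) set)"
    by (rule nonneg_bdd_above_summable_on) (use * in \<open>auto simp: tail_def intro!: bdd_aboveI\<close>)
  have "enormB A \<le> ennreal (\<Sum>\<^sub>\<infinity>k :: int ^ 'd. tail A (linf k))"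
    unfolding enormB_etail
  proof (rule infsum_le_finite_sums)
    fix F :: "(int ^ 'd) set" assume "finite F"
    have "(\<Sum>k\<in>F. etail A (linf k)) = ennreal (\<Sum>k\<in>F. tail A (linf k))"
      by (subst sum_ennreal[symmetric]) (auto simp: ennreal_tail tail_nonneg)
    also have "\<dots> \<le> ennreal (\<Sum>\<^sub>\<infinity>k :: int ^ 'd. tail A (linf k))"
      by (intro ennreal_leI finite_sum_le_infsum s) (auto simp: tail_def \<open>finite F\<close>)
    finally show "(\<Sum>k\<in>F. etail A (linf k)) \<le> ennreal (\<Sum>\<^sub>\<infinity>k :: int ^ 'd. tail A (linf k))" .
  qed (rule nonneg_summable_on_complete, rule zero_le)
  then have "normB A \<le> (\<Sum>\<^sub>\<infinity>k :: int ^ 'd. tail A (linf k))"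
    by (subst (asm) ennreal_normB[symmetric]) (simp add: infsum_nonneg tail_def)
  moreover have "(\<Sum>\<^sub>\<infinity>k :: int ^ 'd. tail A (linf k)) \<le> normB A"
    by (rule infsum_le_finite_sums[OF s]) (rule *)
  ultimately show ?thesis
    using has_sum_infsum[OF s] by simp
qed

lemma tail_antimono: "m \<le> n \<Longrightarrow> tail A n \<le> tail A m"
  using etail_antimono[of m n A] by (simp add: ennreal_tail[symmetric] tail_nonneg)

lemma tail_le_normB: "tail A m \<le> normB A"
  using etail_le_enormB[of A m] by (simp add: ennreal_tail[symmetric] ennreal_normB[symmetric] normB_nonneg)

lemma entry_le_normB: "cmod (A i j) \<le> normB A"
  using entry_le_tail[of 0 i j] tail_le_normB[of 0] linf_nonneg[of "i - j"] by simp

end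

text \<open>The converse of \<open>tail_has_sum\<close>: a decreasing \<open>f\<close> dominating
  the entries also dominates the tails. Closure properties and norm inequalities below reduce to
  exhibiting such an \<open>f\<close>. Monotonicity is asked at nonnegative radii only, so that the
  indicator of radius 0 qualifies for the identity matrix.\<close>

lemma enormB_le_majorant:
  fixes A :: "('d::finite) lmatrix"
  assumes f: "\<And>m n. 0 \<le> m \<Longrightarrow> m \<le> n \<Longrightarrow> f n \<le> f m"
    and le: "\<And>i j. cmod (A i j) \<le> f (linf (i - j))"
    and s: "((\<lambda>k :: int ^ 'd. f (linf k)) has_sum S) UNIV"
  shows "enormB A \<le> ennreal S"
  unfolding enormB_etail
proof (rule infsum_le_finite_sums)
  fix F :: "(int ^ 'd) set" assume F: "finite F"
  \<comment> \<open>Each radius \<open>linf k\<close> is attained by the pair \<open>(k, 0)\<close>,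
    so the entry bound forces \<open>f\<close> to be nonnegative there.\<close>
  have nn: "0 \<le> f (linf k)" for k :: "int ^ 'd"
    using le[of k 0] order_trans[OF norm_ge_zero] by auto
  have "(\<Sum>k\<in>F. etail A (linf k)) \<le> (\<Sum>k\<in>F. ennreal (f (linf k)))"
    by (intro sum_mono) (force simp: etail_le_iff intro!: ennreal_leI order_trans[OF le] f linf_nonneg)
  also have "\<dots> = ennreal (\<Sum>k\<in>F. f (linf k))"
    by (rule sum_ennreal) (rule nn)
  also have "\<dots> \<le> ennreal S"
    by (intro ennreal_leI finite_sum_le_has_sum[OF s F]) (auto simp: nn)
  finally show "(\<Sum>k\<in>F. etail A (linf k)) \<le> ennreal S" .
qed (rule nonneg_summable_on_complete, rule zero_le)

lemma
  fixes A :: "('d::finite) lmatrix"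
  assumes f: "\<And>m n. 0 \<le> m \<Longrightarrow> m \<le> n \<Longrightarrow> f n \<le> f m"
    and le: "\<And>i j. cmod (A i j) \<le> f (linf (i - j))"
    and s: "((\<lambda>k :: int ^ 'd. f (linf k)) has_sum S) UNIV"
  shows classB_majorant: "A \<in> classB" and normB_le_majorant: "normB A \<le> S"
proof -
  have "0 \<le> f (linf k)" for k :: "int ^ 'd"
    using le[of k 0] order_trans[OF norm_ge_zero] by auto
  then have S: "0 \<le> S" using has_sum_nonneg[OF s] by auto
  have *: "enormB A \<le> ennreal S" using enormB_le_majorant[OF assms] .
  then show "A \<in> classB" by (auto simp: classB_def elim: le_less_trans)
  show "normB A \<le> S" unfolding normB_def using * S by (rule enn2real_leI[rotated])
qed

text \<open>The norm sees only absolute values. This supplies the absolute convergence needed to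
  exchange sums in the associativity proofs.\<close>

lemma classB_cmod: "(\<lambda>i j. complex_of_real (cmod (A i j))) \<in> classB \<longleftrightarrow> A \<in> classB"
  by (simp add: classB_def enormB_def)

section \<open>Linear operations, the norm axioms and the identity matrix\<close>

lemma normB_eq_0_iff:
  assumes "A \<in> classB" shows "normB A = 0 \<longleftrightarrow> A = (\<lambda>i j. 0)"
proof
  assume "normB A = 0" then show "A = (\<lambda>i j. 0)"
    using entry_le_normB[OF assms] by (auto simp: fun_eq_iff)
next
  assume A: "A = (\<lambda>i j. 0)"
  have "normB A \<le> 0" by (rule normB_le_majorant[where f = "\<lambda>_. 0"]) (auto simp: A)
  then show "normB A = 0" using normB_nonneg[of A] by simp
qed

lemma
  assumes "A \<in> classB" "B \<in> classB"
  shows classB_add: "(\<lambda>i j. A i j + B i j) \<in> classB"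
    and normB_add: "normB (\<lambda>i j. A i j + B i j) \<le> normB A + normB B"
proof -
  have f: "tail A n + tail B n \<le> tail A m + tail B m" if "m \<le> n" for m n
    using that assms by (intro add_mono tail_antimono)
  have le: "cmod (A i j + B i j) \<le> tail A (linf (i - j)) + tail B (linf (i - j))" for i j
    by (rule order_trans[OF norm_triangle_ineq]) (intro add_mono entry_le_tail assms order_refl)
  note s = has_sum_add[OF tail_has_sum[OF assms(1)] tail_has_sum[OF assms(2)]]
  show "(\<lambda>i j. A i j + B i j) \<in> classB"
    by (rule classB_majorant[OF _ _ s]) (auto intro: f le)
  show "normB (\<lambda>i j. A i j + B i j) \<le> normB A + normB B"
    by (rule normB_le_majorant[OF _ _ s]) (auto intro: f le)
qed

lemma
  assumes "A \<in> classB"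
  shows classB_smult: "(\<lambda>i j. \<alpha> * A i j) \<in> classB"
    and normB_smult_le: "normB (\<lambda>i j. \<alpha> * A i j) \<le> cmod \<alpha> * normB A"
proof -
  have f: "cmod \<alpha> * tail A n \<le> cmod \<alpha> * tail A m" if "m \<le> n" for m n
    using that assms by (intro mult_left_mono tail_antimono) auto
  have le: "cmod (\<alpha> * A i j) \<le> cmod \<alpha> * tail A (linf (i - j))" for i j
    unfolding norm_mult by (intro mult_left_mono entry_le_tail assms order_refl) auto
  note s = has_sum_cmult_right[OF tail_has_sum[OF assms(1)]]
  show "(\<lambda>i j. \<alpha> * A i j) \<in> classB"
    by (rule classB_majorant[OF _ _ s]) (auto intro: f le)
  show "normB (\<lambda>i j. \<alpha> * A i j) \<le> cmod \<alpha> * normB A"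
    by (rule normB_le_majorant[OF _ _ s]) (auto intro: f le)
qed

text \<open>The inequality \<open>normB_smult_le\<close> is used twice, the second time with the
  inverse scalar.\<close>

lemma normB_smult:
  assumes A: "A \<in> classB"
  shows "normB (\<lambda>i j. \<alpha> * A i j) = cmod \<alpha> * normB A"
proof (cases "\<alpha> = 0")
  case True
  then show ?thesis
    using normB_smult_le[OF A, of 0] normB_nonneg[of "\<lambda>i j. 0 * A i j"] by simp
next
  case False
  have "normB (\<lambda>i j. inverse \<alpha> * (\<alpha> * A i j)) \<le> cmod (inverse \<alpha>) * normB (\<lambda>i j. \<alpha> * A i j)"
    by (rule normB_smult_le[OF classB_smult[OF A]])
  also have "(\<lambda>i j. inverse \<alpha> * (\<alpha> * A i j)) = A"
    using False by (simp add: fun_eq_iff)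
  finally have "cmod \<alpha> * normB A \<le> normB (\<lambda>i j. \<alpha> * A i j)"
    using False by (simp add: norm_inverse norm_divide field_simps)
  with normB_smult_le[OF A] show ?thesis by (simp add: antisym)
qed

lemma classB_zero: "(\<lambda>i j. 0) \<in> classB"
  by (rule classB_majorant[where f = "\<lambda>_. 0" and S = 0]) auto

lemma one_has_sum: "((\<lambda>k :: int ^ 'd::finite. if linf k = 0 then 1 else 0 :: real) has_sum 1) UNIV"
  using has_sum_finite_neutralI[of "{0}" "UNIV :: (int ^ 'd) set"
      "\<lambda>k. if linf k = 0 then 1 else 0 :: real" 1] by auto

lemma
  shows classB_one: "(\<lambda>i j. if i = j then 1 else 0 :: complex) \<in> (classB :: ('d::finite) lmatrix set)"
    and normB_one: "normB (\<lambda>i j :: int ^ 'd. if i = j then 1 else 0 :: complex) = 1"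
proof -
  have f: "(if n = 0 then 1 else 0 :: real) \<le> (if m = 0 then 1 else 0)" if "0 \<le> m" "m \<le> n" for m n :: int
    using that by auto
  show c: "(\<lambda>i j. if i = j then 1 else 0 :: complex) \<in> (classB :: 'd lmatrix set)"
    by (rule classB_majorant[OF f _ one_has_sum]) auto
  have "normB (\<lambda>i j :: int ^ 'd. if i = j then 1 else 0 :: complex) \<le> 1"
    by (rule normB_le_majorant[OF f _ one_has_sum]) auto
  moreover have "1 \<le> normB (\<lambda>i j :: int ^ 'd. if i = j then 1 else 0 :: complex)"
    using entry_le_normB[OF c, of 0 0] by simp
  ultimately show "normB (\<lambda>i j :: int ^ 'd. if i = j then 1 else 0 :: complex) = 1" by simp
qed

section \<open>Products of matrices in the class\<close>

lemma
  fixes A :: "('d::finite) lmatrix" and i j :: "int ^ 'd"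
  assumes A: "A \<in> classB"
  shows row_has_sum: "((\<lambda>l. tail A (linf (i - l))) has_sum normB A) UNIV"
    and column_has_sum: "((\<lambda>l. tail A (linf (l - j))) has_sum normB A) UNIV"
  using tail_has_sum[OF A]
  by (simp_all add: has_sum_translate_reflect[of "\<lambda>k. tail A (linf k)" i]
      has_sum_translate[of "\<lambda>k. tail A (linf k)" j])

text \<open>A lattice point is determined by its coordinatewise half and its parities, so
  \<open>half\<close> takes each value at most \<open>2 ^ CARD('d)\<close> times. Since
  \<open>half k\<close> has norm at most the rounded-up half of \<open>linf k\<close>, monotonicity
  bounds the left-hand summand by \<open>f (linf (half k))\<close>.\<close>

lemma halved_has_sum_le:
  fixes f :: "int \<Rightarrow> real"
  assumes f: "\<And>m n. 0 \<le> m \<Longrightarrow> m \<le> n \<Longrightarrow> f n \<le> f m" and nn: "\<And>m. 0 \<le> m \<Longrightarrow> 0 \<le> f m"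
    and s: "((\<lambda>k :: int ^ 'd::finite. f (linf k)) has_sum S) UNIV"
  shows "\<exists>T. ((\<lambda>k :: int ^ 'd. f ((linf k + 1) div 2)) has_sum T) UNIV \<and> T \<le> 2 ^ CARD('d) * S"
proof -
  \<comment> \<open>\<open>E\<close> is the set of parity vectors, with coordinates 0 and 1.\<close>
  define E :: "(int ^ 'd) set" where "E = cube 0 2"
  define half :: "int ^ 'd \<Rightarrow> int ^ 'd" where "half k = (\<chi> m. k $ m div 2)" for k
  define par :: "int ^ 'd \<Rightarrow> int ^ 'd" where "par k = (\<chi> m. k $ m mod 2)" for k
  have E: "par k \<in> E" for k by (auto simp: E_def cube_def par_def)
  have inj: "inj (\<lambda>k. (par k, half k))"
  proof (rule injI, simp, elim conjE)
    fix k l assume "par k = par l" "half k = half l"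
    then have "\<forall>m. k $ m mod 2 = l $ m mod 2 \<and> k $ m div 2 = l $ m div 2"
      by (simp add: par_def half_def vec_eq_iff)
    then show "k = l" unfolding vec_eq_iff by (metis mult_div_mod_eq)
  qed
  \<comment> \<open>The \<open>+ 1\<close> is forced by negative odd coordinates, where floor
    division rounds away from zero: -3 is halved to -2.\<close>
  have half: "linf (half k) \<le> (linf k + 1) div 2" for k
    unfolding linf_le_iff
  proof
    fix m
    have "\<bar>k $ m\<bar> \<le> linf k" by (rule abs_nth_le_linf)
    then show "\<bar>half k $ m\<bar> \<le> (linf k + 1) div 2" by (simp add: half_def)
  qed
  have nn': "0 \<le> f ((linf k + 1) div 2)" for k :: "int ^ 'd"
    by (intro nn) (simp add: linf_nonneg add_increasing2 pos_imp_zdiv_nonneg_iff)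
  have *: "(\<Sum>k\<in>F. f ((linf k + 1) div 2)) \<le> 2 ^ CARD('d) * S" if F: "finite F" for F :: "(int ^ 'd) set"
  proof -
    have "(\<Sum>k\<in>F. f ((linf k + 1) div 2)) \<le> (\<Sum>k\<in>F. f (linf (half k)))"
      by (intro sum_mono f linf_nonneg half)
    \<comment> \<open>By injectivity the sum runs over distinct pairs of parity and half; it is then
      enlarged to the full product of \<open>E\<close> with the set of halves.\<close>
    also have "\<dots> = (\<Sum>(e, k)\<in>(\<lambda>k. (par k, half k)) ` F. f (linf k))"
      using inj by (subst sum.reindex) (auto intro: inj_on_subset)
    also have "\<dots> \<le> (\<Sum>(e, k)\<in>E \<times> half ` F. f (linf k))"
      using F by (intro sum_mono2) (auto simp: E_def E[unfolded E_def] nn linf_nonneg)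
    also have "\<dots> = real (card E) * (\<Sum>k\<in>half ` F. f (linf k))"
      by (simp add: sum.cartesian_product[symmetric])
    also have "\<dots> \<le> real (card E) * S"
      using F by (intro mult_left_mono finite_sum_le_has_sum[OF s]) (auto simp: nn linf_nonneg)
    finally show ?thesis by (simp add: E_def card_cube)
  qed
  have su: "(\<lambda>k :: int ^ 'd. f ((linf k + 1) div 2)) summable_on UNIV"
    by (rule nonneg_bdd_above_summable_on) (use * nn' in \<open>auto intro!: bdd_aboveI\<close>)
  show ?thesis
    using has_sum_infsum[OF su] infsum_le_finite_sums[OF su] * by blast
qed

lemma
  fixes A B :: "('d::finite) lmatrix"
  assumes A: "A \<in> classB" and B: "B \<in> classB"
  shows matrix_prod_abs_summable: "(\<lambda>l. cmod (A i l * B l j)) summable_on UNIV"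
    and classB_mult: "(\<lambda>i j. \<Sum>\<^sub>\<infinity>l. A i l * B l j) \<in> classB"
    and normB_mult: "normB (\<lambda>i j. \<Sum>\<^sub>\<infinity>l. A i l * B l j) \<le> 2 * 2 ^ CARD('d) * normB A * normB B"
proof -
  have s1: "(\<lambda>l. cmod (A i l * B l j)) summable_on UNIV" for i j
  proof (rule summable_on_comparison_test)
    show "(\<lambda>l. tail A (linf (i - l)) * normB B) summable_on UNIV"
      \<comment> \<open>For convergence alone it suffices to bound the second factor by the norm and
        to sum the first along its row.\<close>
      using has_sum_cmult_left[OF row_has_sum[OF A]] by (auto simp: summable_on_def)
    show "cmod (A i l * B l j) \<le> tail A (linf (i - l)) * normB B" for l
      unfolding norm_mult
      by (intro mult_mono entry_le_tail[OF A] entry_le_normB[OF B]) (auto simp: tail_nonneg)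
  qed auto
  then show "(\<lambda>l. cmod (A i l * B l j)) summable_on UNIV" .
  \<comment> \<open>Half the radius, rounded up: two distances both below \<open>h m\<close> add up
    to less than \<open>m\<close>, contradicting the triangle inequality.\<close>
  define h where "h m = (m + 1) div 2" for m :: int
  define f where "f m = tail A (h m) * normB B + normB A * tail B (h m)" for m
  have h: "m \<le> n \<Longrightarrow> h m \<le> h n" for m n by (simp add: h_def zdiv_mono1)
  have f: "m \<le> n \<Longrightarrow> f n \<le> f m" for m n
    unfolding f_def
    by (intro add_mono mult_mono tail_antimono A B h normB_nonneg tail_nonneg order_refl)
  have le: "cmod (\<Sum>\<^sub>\<infinity>l. A i l * B l j) \<le> f (linf (i - j))" for i j
  proof -
    let ?h = "h (linf (i - j))"
    \<comment> \<open>Which distance is large depends on \<open>l\<close>, so both products are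
      added before summing. The remaining kernels are a full column of \<open>B\<close> and a full
      row of \<open>A\<close>.\<close>
    have hs: "((\<lambda>l. tail A ?h * tail B (linf (l - j)) + tail A (linf (i - l)) * tail B ?h)
        has_sum f (linf (i - j))) UNIV"
      unfolding f_def
      by (intro has_sum_add has_sum_cmult_left has_sum_cmult_right row_has_sum column_has_sum A B)
    have "cmod (\<Sum>\<^sub>\<infinity>l. A i l * B l j) \<le> (\<Sum>\<^sub>\<infinity>l. cmod (A i l * B l j))"
      by (rule norm_infsum_bound[OF s1])
    also have "\<dots> \<le> (\<Sum>\<^sub>\<infinity>l. tail A ?h * tail B (linf (l - j)) + tail A (linf (i - l)) * tail B ?h)"
    proof (rule infsum_mono[OF s1])
      show "(\<lambda>l. tail A ?h * tail B (linf (l - j)) + tail A (linf (i - l)) * tail B ?h) summable_on UNIV"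
        using hs by (auto simp: summable_on_def)
      fix l
      have "?h \<le> linf (i - l) \<or> ?h \<le> linf (l - j)"
        using linf_diff_triangle[of i j l] by (auto simp: h_def)
      then show "cmod (A i l * B l j) \<le> tail A ?h * tail B (linf (l - j)) + tail A (linf (i - l)) * tail B ?h"
      proof
        assume "?h \<le> linf (i - l)"
        then have "cmod (A i l * B l j) \<le> tail A ?h * tail B (linf (l - j))"
          unfolding norm_mult by (intro mult_mono entry_le_tail A B) (auto simp: tail_nonneg)
        then show ?thesis by (simp add: add_increasing2 tail_nonneg)
      next
        assume "?h \<le> linf (l - j)"
        then have "cmod (A i l * B l j) \<le> tail A (linf (i - l)) * tail B ?h"
          unfolding norm_mult by (intro mult_mono entry_le_tail A B) (auto simp: tail_nonneg)
        then show ?thesis by (simp add: add_increasing tail_nonneg)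
      qed
    qed
    also have "\<dots> = f (linf (i - j))" using hs by (rule infsumI)
    finally show ?thesis .
  qed
  obtain S where S: "((\<lambda>k :: int ^ 'd. tail A (h (linf k))) has_sum S) UNIV" "S \<le> 2 ^ CARD('d) * normB A"
    using halved_has_sum_le[OF tail_antimono[OF A] tail_nonneg tail_has_sum[OF A]] unfolding h_def by blast
  obtain T where T: "((\<lambda>k :: int ^ 'd. tail B (h (linf k))) has_sum T) UNIV" "T \<le> 2 ^ CARD('d) * normB B"
    using halved_has_sum_le[OF tail_antimono[OF B] tail_nonneg tail_has_sum[OF B]] unfolding h_def by blast
  have s: "((\<lambda>k :: int ^ 'd. f (linf k)) has_sum (S * normB B + normB A * T)) UNIV"
    unfolding f_def by (intro has_sum_add has_sum_cmult_left has_sum_cmult_right S T)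
  show "(\<lambda>i j. \<Sum>\<^sub>\<infinity>l. A i l * B l j) \<in> classB"
    by (rule classB_majorant[OF _ _ s]) (auto intro: f le)
  have "normB (\<lambda>i j. \<Sum>\<^sub>\<infinity>l. A i l * B l j) \<le> S * normB B + normB A * T"
    by (rule normB_le_majorant[OF _ _ s]) (auto intro: f le)
  \<comment> \<open>Each of the two halved tails costs a factor \<open>2 ^ CARD('d)\<close>.\<close>
  also have "\<dots> \<le> (2 ^ CARD('d) * normB A) * normB B + normB A * (2 ^ CARD('d) * normB B)"
    by (intro add_mono mult_mono S T normB_nonneg mult_nonneg_nonneg order_refl has_sum_nonneg[OF T(1)] tail_nonneg) auto
  finally show "normB (\<lambda>i j. \<Sum>\<^sub>\<infinity>l. A i l * B l j) \<le> 2 * 2 ^ CARD('d) * normB A * normB B"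
    by (simp add: ac_simps)
qed

section \<open>Completeness of the matrix class\<close>

text \<open>The norm is lower semicontinuous under entrywise convergence: tails of the limit lie
  below the liminf of the tails, and Fatou's lemma handles their sum.\<close>

lemma enormB_limit_le:
  fixes Y :: "nat \<Rightarrow> ('d::finite) lmatrix"
  assumes lim: "\<And>i j. (\<lambda>n. Y n i j) \<longlonglongrightarrow> Z i j" and le: "\<And>n. enormB (Y n) \<le> e"
  shows "enormB Z \<le> e"
  unfolding enormB_etail
proof (rule infsum_le_finite_sums)
  fix F :: "(int ^ 'd) set" assume F: "finite F"
  have "etail Z m \<le> liminf (\<lambda>n. etail (Y n) m)" for m
    unfolding etail_le_iff
  proof (intro allI impI)
    fix i j :: "int ^ 'd" assume m: "m \<le> linf (i - j)"
    have "(\<lambda>n. ennreal (cmod (Y n i j))) \<longlonglongrightarrow> ennreal (cmod (Z i j))"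
      by (intro tendsto_ennrealI tendsto_norm lim)
    then have "ennreal (cmod (Z i j)) = liminf (\<lambda>n. ennreal (cmod (Y n i j)))"
      by (intro lim_imp_Liminf[symmetric]) auto
    also have "\<dots> \<le> liminf (\<lambda>n. etail (Y n) m)"
      by (intro Liminf_mono always_eventually allI entry_le_etail m)
    finally show "ennreal (cmod (Z i j)) \<le> liminf (\<lambda>n. etail (Y n) m)" .
  qed
  then have "(\<Sum>k\<in>F. etail Z (linf k)) \<le> (\<Sum>k\<in>F. liminf (\<lambda>n. etail (Y n) (linf k)))"
    by (intro sum_mono)
  \<comment> \<open>The finite sum is read as an integral against counting measure, the setting of
    Fatou's lemma.\<close>
  also have "\<dots> = (\<integral>\<^sup>+k. liminf (\<lambda>n. etail (Y n) (linf k)) \<partial>count_space F)"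
    by (rule nn_integral_count_space_finite[OF F, symmetric])
  also have "\<dots> \<le> liminf (\<lambda>n. \<integral>\<^sup>+k. etail (Y n) (linf k) \<partial>count_space F)"
    by (rule nn_integral_liminf) simp
  also have "\<dots> = liminf (\<lambda>n. \<Sum>k\<in>F. etail (Y n) (linf k))"
    by (simp add: nn_integral_count_space_finite[OF F])
  also have "\<dots> \<le> liminf (\<lambda>n. e)"
  proof (intro Liminf_mono always_eventually allI)
    fix n
    have "(\<Sum>k\<in>F. etail (Y n) (linf k)) \<le> enormB (Y n)"
      unfolding enormB_etail using F by (rule sum_le_infsum_ennreal)
    with le[of n] show "(\<Sum>k\<in>F. etail (Y n) (linf k)) \<le> e" by simp
  qed
  finally show "(\<Sum>k\<in>F. etail Z (linf k)) \<le> e" by (simp add: Liminf_const)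
qed (rule nonneg_summable_on_complete, rule zero_le)

lemma classB_diff: "A \<in> classB \<Longrightarrow> B \<in> classB \<Longrightarrow> (\<lambda>i j. A i j - B i j) \<in> classB"
  using classB_add[of A "\<lambda>i j. - 1 * B i j"] classB_smult[of B "- 1"] by simp

text \<open>The norm dominates every entry, so an entrywise limit \<open>Z\<close> exists. Letting
  the second index tend to infinity in the Cauchy estimate, lower semicontinuity turns this into
  convergence in norm.\<close>

lemma classB_complete:
  fixes X :: "nat \<Rightarrow> ('d::finite) lmatrix"
  assumes X: "\<And>n. X n \<in> classB"
    and Cauchy: "\<And>\<epsilon>. 0 < \<epsilon> \<Longrightarrow> \<exists>N. \<forall>m\<ge>N. \<forall>n\<ge>N. normB (\<lambda>i j. X m i j - X n i j) < \<epsilon>"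
  shows "\<exists>Z\<in>classB. (\<lambda>n. normB (\<lambda>i j. X n i j - Z i j)) \<longlonglongrightarrow> 0"
proof -
  have "Cauchy (\<lambda>n. X n i j)" for i j
  proof (rule metric_CauchyI)
    fix \<epsilon> :: real assume "0 < \<epsilon>"
    then obtain N where N: "\<forall>m\<ge>N. \<forall>n\<ge>N. normB (\<lambda>i j. X m i j - X n i j) < \<epsilon>"
      using Cauchy by blast
    have "dist (X m i j) (X n i j) < \<epsilon>" if "m \<ge> N" "n \<ge> N" for m n
      using N[rule_format, OF that] entry_le_normB[OF classB_diff[OF X[of m] X[of n]], of i j]
      by (simp add: dist_norm)
    then show "\<exists>M. \<forall>m\<ge>M. \<forall>n\<ge>M. dist (X m i j) (X n i j) < \<epsilon>" by blast
  qed
  then have "\<exists>z. (\<lambda>n. X n i j) \<longlonglongrightarrow> z" for i j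
    by (simp add: Cauchy_convergent_iff convergent_def)
  then obtain Z where Z: "\<And>i j. (\<lambda>n. X n i j) \<longlonglongrightarrow> Z i j" by metis
  have *: "\<exists>N. \<forall>m\<ge>N. (\<lambda>i j. X m i j - Z i j) \<in> classB \<and> normB (\<lambda>i j. X m i j - Z i j) \<le> \<epsilon>"
    if "0 < \<epsilon>" for \<epsilon>
  proof -
    obtain N where N: "\<forall>m\<ge>N. \<forall>n\<ge>N. normB (\<lambda>i j. X m i j - X n i j) < \<epsilon>"
      using Cauchy[OF \<open>0 < \<epsilon>\<close>] by blast
    have "enormB (\<lambda>i j. X m i j - Z i j) \<le> ennreal \<epsilon>" if m: "m \<ge> N" for m
    proof (rule enormB_limit_le)
      \<comment> \<open>The shift by \<open>N\<close> makes every term of the sequence satisfy the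
        Cauchy estimate.\<close>
      show "(\<lambda>n. X m i j - X (n + N) i j) \<longlonglongrightarrow> X m i j - Z i j" for i j
        by (intro tendsto_diff tendsto_const LIMSEQ_ignore_initial_segment Z)
      show "enormB (\<lambda>i j. X m i j - X (n + N) i j) \<le> ennreal \<epsilon>" for n
        unfolding ennreal_normB[OF classB_diff[OF X X], symmetric]
        using N m by (intro ennreal_leI less_imp_le) simp
    qed
    then show ?thesis
      using \<open>0 < \<epsilon>\<close>
      by (intro exI[of _ N]) (auto simp: classB_def normB_def enn2real_leI
          intro: le_less_trans[OF _ ennreal_less_top])
  qed
  obtain N where "(\<lambda>i j. X N i j - Z i j) \<in> classB" using *[of 1] by auto
  \<comment> \<open>\<open>Z\<close> is recovered as \<open>X N\<close> minus the difference of
    \<open>X N\<close> and \<open>Z\<close>.\<close>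
  from classB_diff[OF X[of N] this] have "Z \<in> classB" by simp
  moreover have "(\<lambda>n. normB (\<lambda>i j. X n i j - Z i j)) \<longlonglongrightarrow> 0"
  proof (rule LIMSEQ_I)
    fix r :: real assume "0 < r"
    then obtain N where "\<forall>m\<ge>N. normB (\<lambda>i j. X m i j - Z i j) \<le> r / 2" using *[of "r / 2"] by auto
    then show "\<exists>N. \<forall>n\<ge>N. norm (normB (\<lambda>i j. X n i j - Z i j) - 0) < r"
      using \<open>0 < r\<close> by (intro exI[of _ N]) (force simp: normB_nonneg)
  qed
  ultimately show ?thesis by blast
qed

section \<open>Averages over cubes and Muckenhoupt weights\<close>

text \<open>Jensen's inequality for the convex power \<open>q\<close>, with the weights \<alpha>
  normalised to total 1 and the denominators cleared afterwards.\<close>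

lemma powr_sum_weighted_le:
  fixes \<alpha> t :: "'a \<Rightarrow> real"
  assumes q: "1 \<le> q" and I: "finite I"
    and \<alpha>: "\<And>i. i \<in> I \<Longrightarrow> 0 \<le> \<alpha> i" and t: "\<And>i. i \<in> I \<Longrightarrow> 0 \<le> t i"
  shows "(\<Sum>i\<in>I. \<alpha> i * t i) powr q \<le> (\<Sum>i\<in>I. \<alpha> i) powr (q - 1) * (\<Sum>i\<in>I. \<alpha> i * t i powr q)"
proof -
  \<comment> \<open>Keeps the terms with positive weight and positive value: division by the total
    weight is then legitimate and convexity is used on positive arguments. The discarded terms
    contribute nothing on the left.\<close>
  define J where "J = {i\<in>I. 0 < \<alpha> i \<and> 0 < t i}"
  have J: "finite J" "J \<subseteq> I" using I by (auto simp: J_def)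
  have eq: "(\<Sum>i\<in>I. \<alpha> i * t i) = (\<Sum>i\<in>J. \<alpha> i * t i)"
    using I \<alpha> t by (intro sum.mono_neutral_right) (force simp: J_def)+
  show ?thesis
  proof (cases "J = {}")
    case True
    then show ?thesis
      by (simp add: eq \<alpha> sum_nonneg)
  next
    case False
    define s where "s = (\<Sum>i\<in>J. \<alpha> i)"
    have s: "0 < s" unfolding s_def using J(1) False by (intro sum_pos) (auto simp: J_def)
    have "(\<Sum>i\<in>J. (\<alpha> i / s) *\<^sub>R t i) powr q \<le> (\<Sum>i\<in>J. \<alpha> i / s * t i powr q)"
      by (rule convex_on_sum[OF J(1) False powr_convex[OF q]])
        (use s in \<open>auto simp: J_def s_def sum_divide_distrib[symmetric]\<close>)
    then have "((\<Sum>i\<in>J. \<alpha> i * t i) / s) powr q \<le> (\<Sum>i\<in>J. \<alpha> i * t i powr q) / s"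
      by (simp add: sum_divide_distrib)
    moreover have "0 \<le> (\<Sum>i\<in>J. \<alpha> i * t i)"
      by (intro sum_nonneg) (auto simp: J_def)
    ultimately have "(\<Sum>i\<in>J. \<alpha> i * t i) powr q \<le> s powr (q - 1) * (\<Sum>i\<in>J. \<alpha> i * t i powr q)"
      using s by (simp add: powr_divide powr_diff field_simps)
    also have "\<dots> \<le> (\<Sum>i\<in>I. \<alpha> i) powr (q - 1) * (\<Sum>i\<in>I. \<alpha> i * t i powr q)"
      unfolding s_def using q J I \<alpha> t
      by (intro mult_mono powr_mono2 sum_mono2 sum_nonneg) auto
    finally show ?thesis by (simp add: eq)
  qed
qed

text \<open>Hoelder's inequality, obtained from Jensen's with the dual weight \<open>s\<close> as
  weights and \<open>c i / s i\<close> as values. The exponent of \<open>s\<close> is the one for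
  which \<open>s i powr (1 - q) = w i\<close>.\<close>

lemma powr_sum_le_dual_weight:
  fixes c w :: "'a \<Rightarrow> real"
  assumes q: "1 < q" and I: "finite I"
    and c: "\<And>i. i \<in> I \<Longrightarrow> 0 \<le> c i" and w: "\<And>i. i \<in> I \<Longrightarrow> 0 < w i"
  shows "(\<Sum>i\<in>I. c i) powr q
    \<le> (\<Sum>i\<in>I. w i powr (- 1 / (q - 1))) powr (q - 1) * (\<Sum>i\<in>I. c i powr q * w i)"
proof -
  define s where "s i = w i powr (- 1 / (q - 1))" for i
  have s: "0 < s i" if "i \<in> I" for i using w[OF that] by (simp add: s_def)
  have *: "s i * (c i / s i) powr q = c i powr q * w i" if i: "i \<in> I" for i
  proof -
    have "s i powr (1 - q) = w i powr 1"
      unfolding s_def powr_powr using q by (intro arg_cong2[where f = "(powr)"]) (auto simp: field_simps)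
    then have "s i powr (1 - q) = w i" using w[OF i] by simp
    moreover have "s i * (c i / s i) powr q = c i powr q * s i powr (1 - q)"
      using s[OF i] c[OF i] by (simp add: powr_divide powr_diff)
    ultimately show ?thesis by simp
  qed
  have "(\<Sum>i\<in>I. c i) = (\<Sum>i\<in>I. s i * (c i / s i))"
    using s by (intro sum.cong) force+
  then have "(\<Sum>i\<in>I. c i) powr q \<le> (\<Sum>i\<in>I. s i) powr (q - 1) * (\<Sum>i\<in>I. s i * (c i / s i) powr q)"
    using powr_sum_weighted_le[of q I s "\<lambda>i. c i / s i"] q I c s by (simp add: less_imp_le)
  also have "(\<Sum>i\<in>I. s i * (c i / s i) powr q) = (\<Sum>i\<in>I. c i powr q * w i)"
    by (intro sum.cong *) auto
  finally show ?thesis by (simp add: s_def)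
qed

section \<open>The Muckenhoupt conditions without denominators\<close>

lemma discrete_weight_pos: "discrete_weight q w \<Longrightarrow> 0 < w i"
  by (simp add: discrete_weight_def)

text \<open>On a finite cube the infimum is a minimum and hence at most the weight at any point. The
  definition does not fix the sign of the constant, so \<open>\<bar>C\<bar>\<close> is taken to make
  this comparison monotone.\<close>

lemma A1_weight_cube:
  fixes w :: "int ^ 'd::finite \<Rightarrow> real"
  assumes "discrete_weight 1 w"
  shows "\<exists>C\<ge>0. \<forall>a N. \<forall>j\<in>cube a N. 1 \<le> N \<longrightarrow> (\<Sum>i\<in>cube a N. w i) \<le> C * real N ^ CARD('d) * w j"
proof -
  obtain C where C: "\<And>a N. 1 \<le> N \<Longrightarrow> cube_mean w a N \<le> C * (INF i\<in>cube a N. w i)"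
    using assms by (auto simp: discrete_weight_def)
  show ?thesis
  proof (intro exI[of _ "\<bar>C\<bar>"] conjI allI ballI impI)
    fix a :: "int ^ 'd" and N j assume j: "j \<in> cube a N" and N: "1 \<le> N"
    have inf: "(INF i\<in>cube a N. w i) = Min (w ` cube a N)"
      using j by (intro cInf_eq_Min) auto
    have "0 \<le> Min (w ` cube a N)"
      using j discrete_weight_pos[OF assms] by (intro Min.boundedI) (auto simp: less_imp_le)
    moreover have "Min (w ` cube a N) \<le> w j"
      using j by (intro Min_le) auto
    ultimately have "C * (INF i\<in>cube a N. w i) \<le> \<bar>C\<bar> * w j"
      unfolding inf by (intro mult_mono) auto
    with C[OF N, of a] have "cube_mean w a N \<le> \<bar>C\<bar> * w j" by simp
    then show "(\<Sum>i\<in>cube a N. w i) \<le> \<bar>C\<bar> * real N ^ CARD('d) * w j"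
      using N by (simp add: cube_mean_def field_simps)
  qed simp
qed

text \<open>The two means are normalised by the cube volume to the powers 1 and
  \<open>q - 1\<close>, which combine to the power \<open>q\<close> on the right.\<close>

lemma Aq_weight_cube:
  fixes w :: "int ^ 'd::finite \<Rightarrow> real"
  assumes q: "1 < q" and w: "discrete_weight q w"
  shows "\<exists>C\<ge>0. \<forall>a N. 1 \<le> N \<longrightarrow>
    (\<Sum>i\<in>cube a N. w i) * (\<Sum>i\<in>cube a N. w i powr (- 1 / (q - 1))) powr (q - 1)
      \<le> C * (real N ^ CARD('d)) powr q"
proof -
  obtain C where C: "\<And>a N. 1 \<le> N \<Longrightarrow>
      cube_mean w a N * cube_mean (\<lambda>i. w i powr (- 1 / (q - 1))) a N powr (q - 1) \<le> C"
    using w q by (auto simp: discrete_weight_def)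
  show ?thesis
  proof (intro exI[of _ "\<bar>C\<bar>"] conjI allI impI)
    fix a :: "int ^ 'd" and N :: nat assume N: "1 \<le> N"
    define n where "n = real N ^ CARD('d)"
    have n: "0 < n" using N by (simp add: n_def)
    let ?s = "\<Sum>i\<in>cube a N. w i powr (- 1 / (q - 1))"
    have "(\<Sum>i\<in>cube a N. w i) / n * (?s / n) powr (q - 1) \<le> \<bar>C\<bar>"
      using C[OF N, of a] by (simp add: cube_mean_def n_def)
    then have "(\<Sum>i\<in>cube a N. w i) * ?s powr (q - 1) / n powr q \<le> \<bar>C\<bar>"
      unfolding powr_divide using n by (simp add: powr_diff)
    then show "(\<Sum>i\<in>cube a N. w i) * ?s powr (q - 1) \<le> \<bar>C\<bar> * (real N ^ CARD('d)) powr q"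
      using n by (simp add: pos_divide_le_eq n_def)
  qed simp
qed

lemma weighted_averages_bounded:
  fixes w :: "int ^ 'd::finite \<Rightarrow> real"
  assumes q: "1 \<le> q" and w: "discrete_weight q w"
  shows "\<exists>K\<ge>0. \<forall>n F G c. finite F \<longrightarrow> finite G \<longrightarrow> (\<forall>j. 0 \<le> c j) \<longrightarrow>
    (\<Sum>i\<in>F. w i * (\<Sum>j | j \<in> G \<and> linf (i - j) \<le> int n. c j) powr q)
      \<le> K * (real (2 * n + 1) ^ CARD('d)) powr q * (\<Sum>j\<in>G. c j powr q * w j)"
proof (cases "q = 1")
  case True
  obtain C where C: "0 \<le> C" "\<And>a N j. j \<in> cube a N \<Longrightarrow> 1 \<le> N \<Longrightarrow>
      (\<Sum>i\<in>cube a N. w i) \<le> C * real N ^ CARD('d) * w j"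
    using A1_weight_cube w True by metis
  show ?thesis
  proof (intro exI[of _ C] conjI allI impI C)
    fix n :: nat and F G :: "(int ^ 'd) set" and c :: "int ^ 'd \<Rightarrow> real"
    assume F: "finite F" and G: "finite G" and c: "\<forall>j. 0 \<le> c j"
    have "(\<Sum>i\<in>F. w i * (\<Sum>j | j \<in> G \<and> linf (i - j) \<le> int n. c j) powr q)
        = (\<Sum>i\<in>F. w i * (\<Sum>j | j \<in> G \<and> linf (i - j) \<le> int n. c j))"
      using c by (simp add: True sum_nonneg)
    also have "\<dots> = (\<Sum>i\<in>F. \<Sum>j | j \<in> G \<and> linf (i - j) \<le> int n. w i * c j)"
      by (simp add: sum_distrib_left)
    \<comment> \<open>After the exchange each \<open>c j\<close> meets the total weight of a ball
      about \<open>j\<close>, which the condition for \<open>q = 1\<close> compares with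
      \<open>w j\<close>.\<close>
    also have "\<dots> = (\<Sum>j\<in>G. \<Sum>i | i \<in> F \<and> linf (i - j) \<le> int n. w i * c j)"
      by (rule sum.swap_restrict[OF F G])
    also have "\<dots> = (\<Sum>j\<in>G. c j * (\<Sum>i | i \<in> F \<and> linf (i - j) \<le> int n. w i))"
      by (simp add: sum_distrib_left mult.commute)
    also have "\<dots> \<le> (\<Sum>j\<in>G. c j * (C * real (2 * n + 1) ^ CARD('d) * w j))"
    proof (intro sum_mono mult_left_mono)
      fix j
      have "(\<Sum>i | i \<in> F \<and> linf (i - j) \<le> int n. w i) \<le> (\<Sum>i | linf (j - i) \<le> int n. w i)"
        by (intro sum_mono2 finite_linf_ball)
          (auto simp: linf_minus_commute less_imp_le discrete_weight_pos[OF w])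
      also have "\<dots> \<le> C * real (2 * n + 1) ^ CARD('d) * w j"
        unfolding linf_ball_eq_cube
        by (rule C) (auto simp: linf_ball_eq_cube[symmetric] simp del: One_nat_def)
      finally show "(\<Sum>i | i \<in> F \<and> linf (i - j) \<le> int n. w i) \<le> C * real (2 * n + 1) ^ CARD('d) * w j" .
    qed (use c in auto)
    also have "\<dots> = C * (real (2 * n + 1) ^ CARD('d)) powr q * (\<Sum>j\<in>G. c j powr q * w j)"
      using c by (simp add: True sum_distrib_left sum_distrib_right ac_simps)
    finally show "(\<Sum>i\<in>F. w i * (\<Sum>j | j \<in> G \<and> linf (i - j) \<le> int n. c j) powr q)
      \<le> C * (real (2 * n + 1) ^ CARD('d)) powr q * (\<Sum>j\<in>G. c j powr q * w j)" .
  qed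
next
  case False
  with q have q: "1 < q" by simp
  obtain C where C: "0 \<le> C" "\<And>a N. 1 \<le> N \<Longrightarrow>
      (\<Sum>i\<in>cube a N. w i) * (\<Sum>i\<in>cube a N. w i powr (- 1 / (q - 1))) powr (q - 1)
        \<le> C * (real N ^ CARD('d)) powr q"
    using Aq_weight_cube[OF q w] by metis
  show ?thesis
  \<comment> \<open>The extra factor pays for doubling the radius:
    \<open>2 * (2 * n) + 1 \<le> 2 * (2 * n + 1)\<close>.\<close>
  proof (intro exI[of _ "C * (2 ^ CARD('d)) powr q"] conjI allI impI)
    fix n :: nat and F G :: "(int ^ 'd) set" and c :: "int ^ 'd \<Rightarrow> real"
    assume F: "finite F" and G: "finite G" and c: "\<forall>j. 0 \<le> c j"
    define \<sigma> where "\<sigma> i = w i powr (- 1 / (q - 1))" for i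
    define V where "V j = (\<Sum>i | linf (j - i) \<le> int (2 * n). \<sigma> i) powr (q - 1)" for j
    define W where "W j = (\<Sum>i | linf (j - i) \<le> int (2 * n). w i)" for j
    have w0: "0 \<le> w i" for i using discrete_weight_pos[OF w, of i] by simp
    have \<sigma>0: "0 \<le> \<sigma> i" for i by (simp add: \<sigma>_def)
    \<comment> \<open>\<open>V j\<close> and \<open>W j\<close> refer to the same ball about
      \<open>j\<close>, so this is the weight condition for one cube.\<close>
    have VW: "V j * W j \<le> C * (2 ^ CARD('d)) powr q * (real (2 * n + 1) ^ CARD('d)) powr q" for j
    proof -
      have "W j * V j \<le> C * (real (2 * (2 * n) + 1) ^ CARD('d)) powr q"
        unfolding V_def W_def linf_ball_eq_cube \<sigma>_def by (rule C) simp
      also have "\<dots> \<le> C * ((2 * real (2 * n + 1)) ^ CARD('d)) powr q"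
        using q C(1) by (intro mult_left_mono powr_mono2 power_mono) auto
      also have "\<dots> = C * (2 ^ CARD('d)) powr q * (real (2 * n + 1) ^ CARD('d)) powr q"
        by (subst power_mult_distrib, subst powr_mult) auto
      finally show ?thesis by (simp add: mult.commute)
    qed
    have "(\<Sum>i\<in>F. w i * (\<Sum>j | j \<in> G \<and> linf (i - j) \<le> int n. c j) powr q)
        \<le> (\<Sum>i\<in>F. w i * (\<Sum>j | j \<in> G \<and> linf (i - j) \<le> int n. V j * (c j powr q * w j)))"
    proof (intro sum_mono mult_left_mono w0)
      fix i
      let ?G = "{j. j \<in> G \<and> linf (i - j) \<le> int n}"
      have "(\<Sum>j\<in>?G. c j) powr q \<le> (\<Sum>j\<in>?G. \<sigma> j) powr (q - 1) * (\<Sum>j\<in>?G. c j powr q * w j)"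
        unfolding \<sigma>_def using q G c discrete_weight_pos[OF w]
        by (intro powr_sum_le_dual_weight) auto
      also have "\<dots> = (\<Sum>j\<in>?G. (\<Sum>j\<in>?G. \<sigma> j) powr (q - 1) * (c j powr q * w j))"
        by (simp add: sum_distrib_left)
      \<comment> \<open>The dual weight over the ball about \<open>i\<close> is replaced by a
        quantity depending on \<open>j\<close> alone; the sums over \<open>i\<close> and
        \<open>j\<close> then separate after an exchange.\<close>
      also have "\<dots> \<le> (\<Sum>j\<in>?G. V j * (c j powr q * w j))"
      proof (intro sum_mono mult_right_mono mult_nonneg_nonneg w0)
        fix j assume j: "j \<in> ?G"
        have "?G \<subseteq> {l. linf (j - l) \<le> int (2 * n)}"
        proof (intro subsetI CollectI)
          fix l assume "l \<in> ?G"
          then show "linf (j - l) \<le> int (2 * n)"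
            using j linf_diff_triangle[of j l i] by (simp add: linf_minus_commute[of j i])
        qed
        then show "(\<Sum>j\<in>?G. \<sigma> j) powr (q - 1) \<le> V j"
          unfolding V_def using q \<sigma>0 by (intro powr_mono2 sum_mono2 finite_linf_ball sum_nonneg) auto
      qed auto
      finally show "(\<Sum>j\<in>?G. c j) powr q \<le> (\<Sum>j\<in>?G. V j * (c j powr q * w j))" .
    qed
    also have "\<dots> = (\<Sum>i\<in>F. \<Sum>j | j \<in> G \<and> linf (i - j) \<le> int n. w i * (V j * (c j powr q * w j)))"
      by (simp add: sum_distrib_left)
    also have "\<dots> = (\<Sum>j\<in>G. \<Sum>i | i \<in> F \<and> linf (i - j) \<le> int n. w i * (V j * (c j powr q * w j)))"
      by (rule sum.swap_restrict[OF F G])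
    also have "\<dots> = (\<Sum>j\<in>G. (\<Sum>i | i \<in> F \<and> linf (i - j) \<le> int n. w i) * (V j * (c j powr q * w j)))"
      by (simp add: sum_distrib_right)
    \<comment> \<open>This ball is enlarged from radius \<open>n\<close> to \<open>2 * n\<close> to
      match the one in \<open>V j\<close>.\<close>
    also have "\<dots> \<le> (\<Sum>j\<in>G. W j * (V j * (c j powr q * w j)))"
    proof (intro sum_mono mult_right_mono mult_nonneg_nonneg w0)
      fix j
      show "(\<Sum>i | i \<in> F \<and> linf (i - j) \<le> int n. w i) \<le> W j"
        unfolding W_def
        by (intro sum_mono2 finite_linf_ball) (auto simp: linf_minus_commute[of j] w0)
    qed (auto simp: V_def)
    also have "\<dots> = (\<Sum>j\<in>G. (V j * W j) * (c j powr q * w j))"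
      by (simp add: ac_simps)
    also have "\<dots> \<le> (\<Sum>j\<in>G. (C * (2 ^ CARD('d)) powr q * (real (2 * n + 1) ^ CARD('d)) powr q) * (c j powr q * w j))"
      by (intro sum_mono mult_right_mono mult_nonneg_nonneg w0 VW) auto
    also have "\<dots> = C * (2 ^ CARD('d)) powr q * (real (2 * n + 1) ^ CARD('d)) powr q * (\<Sum>j\<in>G. c j powr q * w j)"
      by (simp add: sum_distrib_left)
    finally show "(\<Sum>i\<in>F. w i * (\<Sum>j | j \<in> G \<and> linf (i - j) \<le> int n. c j) powr q)
      \<le> C * (2 ^ CARD('d)) powr q * (real (2 * n + 1) ^ CARD('d)) powr q * (\<Sum>j\<in>G. c j powr q * w j)" .
  qed (use C in auto)
qed

text \<open>Below, \<open>b n\<close> are the coefficients of the layer-cake decomposition of \<open>f\<close> and \<open>\<alpha> n\<close> those with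
  respect to averages instead of indicators; the \<open>\<alpha> n\<close> add up to a partial sum of the kernel.\<close>

lemma weighted_radial_kernel_bounded:
  fixes w :: "int ^ 'd::finite \<Rightarrow> real"
  assumes q: "1 \<le> q" and w: "discrete_weight q w"
  shows "\<exists>K\<ge>0. \<forall>f S F G c. antimono f \<longrightarrow> (\<forall>m. 0 \<le> f m) \<longrightarrow>
    ((\<lambda>k :: int ^ 'd. f (linf k)) has_sum S) UNIV \<longrightarrow>
    finite F \<longrightarrow> finite G \<longrightarrow> (\<forall>j. 0 \<le> c j) \<longrightarrow>
    (\<Sum>i\<in>F. w i * (\<Sum>j\<in>G. f (linf (i - j)) * c j) powr q) \<le> K * S powr q * (\<Sum>j\<in>G. c j powr q * w j)"
proof -
  define bound where "bound K n F G c \<longleftrightarrow> (\<Sum>i\<in>F. w i * (\<Sum>j | j \<in> G \<and> linf (i - j) \<le> int n. c j) powr q)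
      \<le> K * (real (2 * n + 1) ^ CARD('d)) powr q * (\<Sum>j\<in>G. c j powr q * w j)" for K n F G c
  obtain K where K: "0 \<le> K" "\<forall>n F G c. finite F \<longrightarrow> finite G \<longrightarrow> (\<forall>j. 0 \<le> c j) \<longrightarrow> bound K n F G c"
    using weighted_averages_bounded[OF q w] unfolding bound_def by (elim exE conjE)
  show ?thesis
  proof (intro exI[of _ K] conjI allI impI K(1))
    fix f :: "int \<Rightarrow> real" and S :: real and F G :: "(int ^ 'd) set" and c :: "int ^ 'd \<Rightarrow> real"
    assume f: "antimono f" and f0: "\<forall>m. 0 \<le> f m"
      and S: "((\<lambda>k :: int ^ 'd. f (linf k)) has_sum S) UNIV"
      and F: "finite F" and G: "finite G" and c: "\<forall>j. 0 \<le> c j"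
    have w0: "0 \<le> w i" for i using discrete_weight_pos[OF w, of i] by simp
    \<comment> \<open>Only distances between \<open>F\<close> and \<open>G\<close> occur, so layers
      up to \<open>M\<close> suffice; inserting 0 covers empty \<open>F\<close> or
      \<open>G\<close>.\<close>
    define M where "M = nat (Max (insert 0 ((\<lambda>(i, j). linf (i - j)) ` (F \<times> G))))"
    have M: "linf (i - j) \<le> int M" if "i \<in> F" "j \<in> G" for i j
    proof -
      have "linf (i - j) \<le> Max (insert 0 ((\<lambda>(i, j). linf (i - j)) ` (F \<times> G)))"
        using that F G by (intro Max_ge) auto
      then show ?thesis by (simp add: M_def)
    qed
    \<comment> \<open>The last layer carries \<open>f (int M)\<close> itself, so that the
      telescoping sum is exact for radii up to \<open>M\<close> without using the tail of
      \<open>f\<close>.\<close>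
    define b where "b n = (if n < M then f (int n) - f (int n + 1) else f (int n))" for n
    have b0: "0 \<le> b n" for n using f0 antimonoD[OF f, of "int n" "int n + 1"] by (simp add: b_def)
    have layer: "f m = (\<Sum>n | n \<le> M \<and> m \<le> int n. b n)" if "0 \<le> m" "m \<le> int M" for m
    proof -
      obtain k where k: "m = int k" using \<open>0 \<le> m\<close> nonneg_int_cases by blast
      have "k \<le> M" using that k by simp
      then have "f (int k) = (\<Sum>n\<in>{k..M}. b n)"
      proof (induction k rule: inc_induct)
        case base then show ?case by (simp add: b_def)
      next
        case (step k)
        then have "(\<Sum>n\<in>{k..M}. b n) = b k + (\<Sum>n\<in>{Suc k..M}. b n)"
          by (intro sum.atLeast_Suc_atMost) simp
        then show ?case using step by (simp add: b_def add.commute)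
      qed
      also have "{k..M} = {n. n \<le> M \<and> m \<le> int n}" using k by auto
      finally show ?thesis by (simp add: k)
    qed
    \<comment> \<open>\<open>v n\<close> is the number of points in a ball of radius
      \<open>n\<close>, and \<open>t i n\<close> below averages over the ball about
      \<open>i\<close>, counting only points of \<open>G\<close>.\<close>
    define v where "v n = real (2 * n + 1) ^ CARD('d)" for n
    have v: "0 < v n" for n by (simp add: v_def)
    define \<alpha> where "\<alpha> n = b n * v n" for n
    define t where "t i n = (\<Sum>j | j \<in> G \<and> linf (i - j) \<le> int n. c j) / v n" for i n
    have \<alpha>0: "0 \<le> \<alpha> n" for n using b0[of n] v[of n] by (simp add: \<alpha>_def)
    have t0: "0 \<le> t i n" for i n using v[of n] c by (simp add: t_def sum_nonneg)
    \<comment> \<open>Each \<open>v n\<close> is expanded as a count of lattice points; after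
      exchanging the sums, \<open>layer\<close> rebuilds \<open>f\<close> at every point of the ball
      of radius \<open>M\<close>.\<close>
    have "(\<Sum>n\<le>M. \<alpha> n) = (\<Sum>n\<le>M. \<Sum>k | k \<in> {k :: int ^ 'd. linf (0 - k) \<le> int M} \<and> linf k \<le> int n. b n)"
    proof (intro sum.cong refl)
      fix n assume n: "n \<in> {..M}"
      have "{k. k \<in> {k :: int ^ 'd. linf (0 - k) \<le> int M} \<and> linf k \<le> int n} = {k. linf (0 - k) \<le> int n}"
        using n by auto
      then show "\<alpha> n = (\<Sum>k | k \<in> {k :: int ^ 'd. linf (0 - k) \<le> int M} \<and> linf k \<le> int n. b n)"
        by (simp only: sum_constant card_linf_ball \<alpha>_def v_def of_nat_power mult.commute)
    qed
    also have "\<dots> = (\<Sum>k | linf (0 - k :: int ^ 'd) \<le> int M. \<Sum>n | n \<in> {..M} \<and> linf k \<le> int n. b n)"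
      by (rule sum.swap_restrict[OF finite_atMost finite_linf_ball])
    also have "\<dots> = (\<Sum>k | linf (0 - k :: int ^ 'd) \<le> int M. f (linf k))"
      by (intro sum.cong refl) (simp add: layer linf_nonneg)
    also have "\<dots> \<le> S"
      by (rule finite_sum_le_has_sum[OF S finite_linf_ball]) (auto simp: f0)
    finally have \<alpha>S: "(\<Sum>n\<le>M. \<alpha> n) \<le> S" .
    \<comment> \<open>Jensen's inequality, with weights \<alpha>, moves the power inside the sum
      over layers.\<close>
    have "(\<Sum>i\<in>F. w i * (\<Sum>j\<in>G. f (linf (i - j)) * c j) powr q)
      \<le> (\<Sum>i\<in>F. w i * ((\<Sum>n\<le>M. \<alpha> n) powr (q - 1) * (\<Sum>n\<le>M. \<alpha> n * t i n powr q)))"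
    proof (intro sum_mono mult_left_mono w0)
      fix i assume i: "i \<in> F"
      have "(\<Sum>j\<in>G. f (linf (i - j)) * c j) = (\<Sum>j\<in>G. \<Sum>n | n \<in> {..M} \<and> linf (i - j) \<le> int n. b n * c j)"
        using M[OF i] by (intro sum.cong refl) (simp add: layer linf_nonneg sum_distrib_right)
      also have "\<dots> = (\<Sum>n\<le>M. \<Sum>j | j \<in> G \<and> linf (i - j) \<le> int n. b n * c j)"
        by (rule sum.swap_restrict) (auto simp: G)
      also have "\<dots> = (\<Sum>n\<le>M. \<alpha> n * t i n)"
        using v by (simp add: \<alpha>_def t_def sum_distrib_left[symmetric] less_imp_neq[symmetric])
      finally show "(\<Sum>j\<in>G. f (linf (i - j)) * c j) powr q
          \<le> (\<Sum>n\<le>M. \<alpha> n) powr (q - 1) * (\<Sum>n\<le>M. \<alpha> n * t i n powr q)"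
        using powr_sum_weighted_le[OF q, of "{..M}" \<alpha> "t i"] \<alpha>0 t0 by simp
    qed
    also have "\<dots> = (\<Sum>n\<le>M. \<alpha> n) powr (q - 1) * (\<Sum>i\<in>F. \<Sum>n\<le>M. \<alpha> n * (w i * t i n powr q))"
      by (simp add: sum_distrib_left mult_ac)
    also have "(\<Sum>i\<in>F. \<Sum>n\<le>M. \<alpha> n * (w i * t i n powr q)) = (\<Sum>n\<le>M. \<alpha> n * (\<Sum>i\<in>F. w i * t i n powr q))"
      by (subst sum.swap) (simp add: sum_distrib_left)
    also have "(\<Sum>n\<le>M. \<alpha> n) powr (q - 1) * \<dots>
        \<le> (\<Sum>n\<le>M. \<alpha> n) powr (q - 1) * (\<Sum>n\<le>M. \<alpha> n * (K * (\<Sum>j\<in>G. c j powr q * w j)))"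
    proof (intro mult_left_mono sum_mono \<alpha>0)
      fix n
      \<comment> \<open>The volume factor in \<open>bound\<close> cancels against
        \<open>v n powr q\<close>, leaving an estimate uniform in \<open>n\<close>.\<close>
      have "(\<Sum>i\<in>F. w i * t i n powr q)
          = (\<Sum>i\<in>F. w i * (\<Sum>j | j \<in> G \<and> linf (i - j) \<le> int n. c j) powr q) / v n powr q"
        unfolding t_def powr_divide by (simp only: times_divide_eq_right sum_divide_distrib)
      also have "\<dots> \<le> K * (v n) powr q * (\<Sum>j\<in>G. c j powr q * w j) / v n powr q"
        using K(2)[rule_format, of F G c n, unfolded bound_def] F G c
        by (intro divide_right_mono) (auto simp: v_def)
      also have "\<dots> = K * (\<Sum>j\<in>G. c j powr q * w j)"
        using v[of n] by simp
      finally show "(\<Sum>i\<in>F. w i * t i n powr q) \<le> K * (\<Sum>j\<in>G. c j powr q * w j)" .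
    qed simp
    \<comment> \<open>The exponents \<open>q - 1\<close> and 1 add up when the total is nonzero;
      when it is zero both sides vanish.\<close>
    also have "\<dots> = (\<Sum>n\<le>M. \<alpha> n) powr q * (K * (\<Sum>j\<in>G. c j powr q * w j))"
    proof (cases "(\<Sum>n\<le>M. \<alpha> n) = 0")
      case False
      moreover have "0 \<le> (\<Sum>n\<le>M. \<alpha> n)" by (intro sum_nonneg \<alpha>0)
      ultimately show ?thesis by (simp add: powr_diff sum_distrib_right[symmetric])
    qed simp
    also have "\<dots> \<le> S powr q * (K * (\<Sum>j\<in>G. c j powr q * w j))"
      using q \<alpha>S K(1) w0
      by (intro mult_right_mono powr_mono2 mult_nonneg_nonneg sum_nonneg \<alpha>0) auto
    finally show "(\<Sum>i\<in>F. w i * (\<Sum>j\<in>G. f (linf (i - j)) * c j) powr q)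
        \<le> K * S powr q * (\<Sum>j\<in>G. c j powr q * w j)"
      by (simp add: mult_ac)
  qed
qed

section \<open>Matrices acting on weighted sequence spaces\<close>

text \<open>The \<open>q\<close>-th power of the norm. Boundedness can be expressed through it
  without roots and without Minkowski's inequality.\<close>

definition lq_mass :: "real \<Rightarrow> (int ^ 'd \<Rightarrow> real) \<Rightarrow> 'd lseq \<Rightarrow> real" where
  "lq_mass q w c = (\<Sum>\<^sub>\<infinity>i. cmod (c i) powr q * w i)"

context
  fixes q :: real and w :: "int ^ 'd::finite \<Rightarrow> real"
  assumes q: "1 \<le> q" and w: "discrete_weight q w"
begin

lemma weight_nonneg: "0 \<le> w i"
  using discrete_weight_pos[OF w, of i] by simp

lemma lq_mass_nonneg: "0 \<le> lq_mass q w c"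
  unfolding lq_mass_def by (intro infsum_nonneg mult_nonneg_nonneg weight_nonneg) simp

lemma lq_norm_eq_mass: "lq_norm q w c = lq_mass q w c powr (1 / q)"
  by (simp add: lq_norm_def lq_mass_def)

lemma lq_norm_powr: "lq_norm q w c powr q = lq_mass q w c"
  using q by (simp add: lq_norm_eq_mass powr_powr lq_mass_nonneg)

text \<open>Raising to the power \<open>q\<close>, or \<open>1 / q\<close>, translates one kind of
  bound into the other; the constants change by the same power.\<close>

lemma lq_norm_bound_iff:
  "(\<exists>K. \<forall>c\<in>S. lq_norm q w (T c) \<le> K * lq_norm q w c) \<longleftrightarrow>
   (\<exists>K\<ge>0. \<forall>c\<in>S. lq_mass q w (T c) \<le> K * lq_mass q w c)"
proof
  assume "\<exists>K. \<forall>c\<in>S. lq_norm q w (T c) \<le> K * lq_norm q w c"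
  then obtain K where K: "\<And>c. c \<in> S \<Longrightarrow> lq_norm q w (T c) \<le> K * lq_norm q w c" by blast
  show "\<exists>K\<ge>0. \<forall>c\<in>S. lq_mass q w (T c) \<le> K * lq_mass q w c"
  proof (intro exI[of _ "\<bar>K\<bar> powr q"] conjI ballI)
    fix c assume "c \<in> S"
    have nn: "0 \<le> lq_norm q w c" "0 \<le> lq_norm q w (T c)" by (simp_all add: lq_norm_def)
    have "lq_norm q w (T c) \<le> \<bar>K\<bar> * lq_norm q w c"
      using K[OF \<open>c \<in> S\<close>] nn by (meson abs_ge_self mult_right_mono order_trans)
    then have "lq_norm q w (T c) powr q \<le> (\<bar>K\<bar> * lq_norm q w c) powr q"
      using q nn by (intro powr_mono2) auto
    then show "lq_mass q w (T c) \<le> \<bar>K\<bar> powr q * lq_mass q w c"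
      using nn by (simp add: powr_mult lq_norm_powr)
  qed simp
next
  assume "\<exists>K\<ge>0. \<forall>c\<in>S. lq_mass q w (T c) \<le> K * lq_mass q w c"
  then obtain K where K: "0 \<le> K" "\<And>c. c \<in> S \<Longrightarrow> lq_mass q w (T c) \<le> K * lq_mass q w c" by blast
  have "lq_norm q w (T c) \<le> K powr (1 / q) * lq_norm q w c" if "c \<in> S" for c
  proof -
    have "lq_mass q w (T c) powr (1 / q) \<le> (K * lq_mass q w c) powr (1 / q)"
      using q K(2)[OF that] by (intro powr_mono2 lq_mass_nonneg) auto
    then show ?thesis using K(1) by (simp add: lq_norm_eq_mass powr_mult lq_mass_nonneg)
  qed
  then show "\<exists>K. \<forall>c\<in>S. lq_norm q w (T c) \<le> K * lq_norm q w c" by blast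
qed

text \<open>The sum is at most twice the larger of the two moduli. The crude constant replaces the
  triangle inequality because only boundedness of operators is at stake.\<close>

lemma
  assumes c: "c \<in> lq_space q w" and c': "c' \<in> lq_space q w"
  shows lq_space_add: "(\<lambda>i. c i + c' i) \<in> lq_space q w"
    and lq_mass_add: "lq_mass q w (\<lambda>i. c i + c' i) \<le> 2 powr q * (lq_mass q w c + lq_mass q w c')"
proof -
  let ?g = "\<lambda>i. 2 powr q * (cmod (c i) powr q * w i + cmod (c' i) powr q * w i)"
  have le: "cmod (c i + c' i) powr q * w i \<le> ?g i" for i
  proof -
    define m where "m = max (cmod (c i)) (cmod (c' i))"
    have "cmod (c i + c' i) \<le> 2 * m"
      using norm_triangle_ineq[of "c i" "c' i"] by (simp add: m_def)
    then have "cmod (c i + c' i) powr q \<le> (2 * m) powr q"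
      using q by (intro powr_mono2) auto
    also have "\<dots> = 2 powr q * m powr q"
      by (rule powr_mult; simp add: m_def le_max_iff_disj)
    also have "\<dots> \<le> 2 powr q * (cmod (c i) powr q + cmod (c' i) powr q)"
      by (intro mult_left_mono) (auto simp: m_def max_def)
    finally show ?thesis
      using mult_right_mono[OF _ weight_nonneg[of i]] by (simp add: ring_distribs) (smt (verit) mult.assoc ring_distribs)
  qed
  have s: "(\<lambda>i. cmod (c i) powr q * w i) summable_on UNIV" "(\<lambda>i. cmod (c' i) powr q * w i) summable_on UNIV"
    using c c' by (simp_all add: lq_space_def)
  then have g: "?g summable_on UNIV"
    by (intro summable_on_cmult_right summable_on_add)
  have a: "(\<lambda>i. cmod (c i + c' i) powr q * w i) summable_on UNIV"
    using weight_nonneg le by (intro summable_on_comparison_test[OF g]) auto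
  then show "(\<lambda>i. c i + c' i) \<in> lq_space q w" by (simp add: lq_space_def)
  have "lq_mass q w (\<lambda>i. c i + c' i) \<le> (\<Sum>\<^sub>\<infinity>i. ?g i)"
    unfolding lq_mass_def by (intro infsum_mono a g le)
  also have "\<dots> = 2 powr q * (lq_mass q w c + lq_mass q w c')"
    unfolding lq_mass_def by (simp only: infsum_cmult_right' infsum_add[OF s])
  finally show "lq_mass q w (\<lambda>i. c i + c' i) \<le> 2 powr q * (lq_mass q w c + lq_mass q w c')" .
qed

lemma
  shows lq_space_scale: "c \<in> lq_space q w \<Longrightarrow> (\<lambda>i. \<alpha> * c i) \<in> lq_space q w"
    and lq_mass_scale: "lq_mass q w (\<lambda>i. \<alpha> * c i) = cmod \<alpha> powr q * lq_mass q w c"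
  by (simp_all add: lq_space_def lq_mass_def norm_mult powr_mult mult.assoc
      summable_on_cmult_right infsum_cmult_right')

lemma lq_space_zero: "(\<lambda>i. 0) \<in> lq_space q w"
  by (simp add: lq_space_def)

text \<open>Unit sequences read off the columns of a matrix and so give injectivity of
  \<open>matrix_operator\<close>.\<close>

lemma lq_space_unit: "(\<lambda>i. if i = j then 1 else 0) \<in> lq_space q w"
  unfolding lq_space_def mem_Collect_eq
  by (rule finite_nonzero_values_imp_summable_on, rule finite_subset[of _ "{j}"]) auto

lemma lq_space_cmod: "(\<lambda>i. complex_of_real (cmod (c i))) \<in> lq_space q w \<longleftrightarrow> c \<in> lq_space q w"
  by (simp add: lq_space_def)

text \<open>The entries are dominated by the kernel \<open>tail A\<close>, whose total is
  \<open>normB A\<close>. The finite kernel estimate yields convergence of each row, membership and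
  the bound, with \<open>K\<close> uniform in \<open>A\<close> and \<open>c\<close>.\<close>

lemma matrix_action_bounded:
  "\<exists>K\<ge>0. \<forall>A\<in>classB. \<forall>c\<in>lq_space q w.
     (\<forall>i. (\<lambda>j. cmod (A i j * c j)) summable_on UNIV) \<and>
     (\<lambda>i. \<Sum>\<^sub>\<infinity>j. A i j * c j) \<in> lq_space q w \<and>
     lq_mass q w (\<lambda>i. \<Sum>\<^sub>\<infinity>j. A i j * c j) \<le> K * normB A powr q * lq_mass q w c"
proof -
  define bound where "bound K f S F G c \<longleftrightarrow>
    (\<Sum>i\<in>F. w i * (\<Sum>j\<in>G. f (linf (i - j)) * c j) powr q) \<le> K * S powr q * (\<Sum>j\<in>G. c j powr q * w j)"
    for K and f :: "int \<Rightarrow> real" and S F G c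
  obtain K where K: "0 \<le> K" "\<forall>f S F G c. antimono f \<longrightarrow> (\<forall>m. 0 \<le> f m) \<longrightarrow>
    ((\<lambda>k :: int ^ 'd. f (linf k)) has_sum S) UNIV \<longrightarrow>
    finite F \<longrightarrow> finite G \<longrightarrow> (\<forall>j. 0 \<le> c j) \<longrightarrow> bound K f S F G c"
    using weighted_radial_kernel_bounded[OF q w] unfolding bound_def by (elim exE conjE)
  show ?thesis
  proof (intro exI[of _ K] conjI K(1) ballI)
    fix A :: "'d lmatrix" and c assume A: "A \<in> classB" and c: "c \<in> lq_space q w"
    define R where "R = K * normB A powr q * lq_mass q w c"
    have fin: "(\<Sum>i\<in>F. w i * (\<Sum>j\<in>G. cmod (A i j * c j)) powr q) \<le> R"
      if F: "finite F" and G: "finite G" for F G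
    proof -
      have "(\<Sum>i\<in>F. w i * (\<Sum>j\<in>G. cmod (A i j * c j)) powr q)
          \<le> (\<Sum>i\<in>F. w i * (\<Sum>j\<in>G. tail A (linf (i - j)) * cmod (c j)) powr q)"
        unfolding norm_mult using q
        by (intro sum_mono mult_left_mono weight_nonneg powr_mono2 sum_nonneg mult_right_mono
            entry_le_tail[OF A]) auto
      also have "\<dots> \<le> K * normB A powr q * (\<Sum>j\<in>G. cmod (c j) powr q * w j)"
        using K(2)[rule_format, of "tail A" "normB A" F G "\<lambda>j. cmod (c j)", unfolded bound_def]
          F G tail_has_sum[OF A] tail_antimono[OF A] tail_nonneg[of A] by (simp add: monotone_on_def)
      also have "\<dots> \<le> R"
        unfolding R_def lq_mass_def using c K(1) G weight_nonneg
        by (intro mult_left_mono finite_sum_le_infsum) (auto simp: lq_space_def)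
      finally show ?thesis .
    qed
    have su: "(\<lambda>j. cmod (A i j * c j)) summable_on UNIV" for i
    proof (rule nonneg_bdd_above_summable_on)
      show "bdd_above (sum (\<lambda>j. cmod (A i j * c j)) ` {F. F \<subseteq> UNIV \<and> finite F})"
      proof (rule bdd_aboveI2)
        fix G assume "G \<in> {F :: (int ^ 'd) set. F \<subseteq> UNIV \<and> finite F}"
        then have G: "finite G" by simp
        define x where "x = (\<Sum>j\<in>G. cmod (A i j * c j))"
        have x: "0 \<le> x" unfolding x_def by (intro sum_nonneg) auto
        have wi: "0 < w i" by (rule discrete_weight_pos[OF w])
        \<comment> \<open>Taking the one-point set \<open>{i}\<close> isolates a single row;
          positivity of \<open>w i\<close> then bounds its absolute partial sums.\<close>
        have "w i * x powr q \<le> R" using fin[of "{i}" G] G by (simp add: x_def)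
        then have "x powr q \<le> R / w i" using wi by (simp add: field_simps)
        then have "(x powr q) powr (1 / q) \<le> (R / w i) powr (1 / q)"
          using q by (intro powr_mono2) auto
        then show "(\<Sum>j\<in>G. cmod (A i j * c j)) \<le> (R / w i) powr (1 / q)"
          using q x by (simp add: powr_powr x_def)
      qed
    qed simp
    then show "\<forall>i. (\<lambda>j. cmod (A i j * c j)) summable_on UNIV" ..
    define s where "s i = (\<Sum>\<^sub>\<infinity>j. cmod (A i j * c j))" for i
    have s: "(\<Sum>i\<in>F. cmod (\<Sum>\<^sub>\<infinity>j. A i j * c j) powr q * w i) \<le> R" if F: "finite F" for F
    proof -
      have "(\<Sum>i\<in>F. cmod (\<Sum>\<^sub>\<infinity>j. A i j * c j) powr q * w i) \<le> (\<Sum>i\<in>F. w i * s i powr q)"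
        unfolding s_def mult.commute[of _ "w _"] using q
        by (intro sum_mono mult_left_mono weight_nonneg powr_mono2 norm_infsum_bound[OF su]) auto
      also have "\<dots> \<le> R"
      \<comment> \<open>\<open>F\<close> stays fixed while \<open>G\<close> grows to the whole
        lattice; continuity of the power carries the bound to the limit.\<close>
      proof (rule tendsto_upperbound)
        have "((\<lambda>G. \<Sum>j\<in>G. cmod (A i j * c j)) \<longlongrightarrow> s i) (finite_subsets_at_top UNIV)" for i
          unfolding s_def by (rule infsum_tendsto[OF su])
        then show "((\<lambda>G. \<Sum>i\<in>F. w i * (\<Sum>j\<in>G. cmod (A i j * c j)) powr q) \<longlongrightarrow> (\<Sum>i\<in>F. w i * s i powr q))
            (finite_subsets_at_top UNIV)"
          using q by (intro tendsto_sum tendsto_mult tendsto_const tendsto_powr')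
            (auto intro!: always_eventually sum_nonneg)
        show "\<forall>\<^sub>F G in finite_subsets_at_top UNIV. (\<Sum>i\<in>F. w i * (\<Sum>j\<in>G. cmod (A i j * c j)) powr q) \<le> R"
          by (rule eventually_finite_subsets_at_top_weakI) (rule fin[OF F])
      qed simp
      finally show ?thesis .
    qed
    have sum: "(\<lambda>i. cmod (\<Sum>\<^sub>\<infinity>j. A i j * c j) powr q * w i) summable_on UNIV"
      by (rule nonneg_bdd_above_summable_on)
        (use s weight_nonneg in \<open>auto intro!: bdd_aboveI2[where M = R]\<close>)
    then show "(\<lambda>i. \<Sum>\<^sub>\<infinity>j. A i j * c j) \<in> lq_space q w" by (simp add: lq_space_def)
    have "lq_mass q w (\<lambda>i. \<Sum>\<^sub>\<infinity>j. A i j * c j) \<le> R"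
      unfolding lq_mass_def by (rule infsum_le_finite_sums[OF sum]) (rule s)
    then show "lq_mass q w (\<lambda>i. \<Sum>\<^sub>\<infinity>j. A i j * c j) \<le> K * normB A powr q * lq_mass q w c"
      by (simp add: R_def)
  qed
qed

lemma
  assumes "A \<in> classB" "c \<in> lq_space q w"
  shows matrix_action_abs_summable: "(\<lambda>j. cmod (A i j * c j)) summable_on UNIV"
    and matrix_action_in_lq_space: "(\<lambda>i. \<Sum>\<^sub>\<infinity>j. A i j * c j) \<in> lq_space q w"
  using matrix_action_bounded assms by blast+

end

section \<open>Associativity of infinite products\<close>

text \<open>Fubini for series: the assumptions say that the iterated sum of absolute values is
  finite, which allows the exchange. \<open>v\<close> stands for a column of a matrix or for a
  sequence.\<close>

lemma infsum_mult_assoc: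
  fixes u :: "'l \<Rightarrow> complex" and B :: "'l \<Rightarrow> 'm \<Rightarrow> complex" and v :: "'m \<Rightarrow> complex"
  assumes inner: "\<And>l. (\<lambda>m. cmod (B l m * v m)) summable_on UNIV"
    and outer: "(\<lambda>l. cmod (u l) * (\<Sum>\<^sub>\<infinity>m. cmod (B l m * v m))) summable_on UNIV"
  shows "(\<Sum>\<^sub>\<infinity>m. (\<Sum>\<^sub>\<infinity>l. u l * B l m) * v m) = (\<Sum>\<^sub>\<infinity>l. u l * (\<Sum>\<^sub>\<infinity>m. B l m * v m))"
proof -
  have "(\<lambda>x. cmod (case x of (l, m) \<Rightarrow> u l * (B l m * v m))) summable_on UNIV \<times> UNIV"
    unfolding Infinite_Sum.abs_summable_on_Sigma_iff
  proof (intro conjI ballI)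
    show "(\<lambda>m. cmod (case (l, m) of (l, m) \<Rightarrow> u l * (B l m * v m))) summable_on UNIV" for l
      using summable_on_cmult_right[OF inner[of l], of "cmod (u l)"] by (simp add: norm_mult)
    have "(\<Sum>\<^sub>\<infinity>m. cmod (u l * (B l m * v m))) = cmod (u l) * (\<Sum>\<^sub>\<infinity>m. cmod (B l m * v m))" for l
      by (simp only: norm_mult[of "u l"] infsum_cmult_right')
    then show "(\<lambda>l. norm (\<Sum>\<^sub>\<infinity>m. cmod (case (l, m) of (l, m) \<Rightarrow> u l * (B l m * v m)))) summable_on UNIV"
      using outer by (simp add: infsum_nonneg)
  qed
  then have "(\<lambda>(l, m). u l * (B l m * v m)) summable_on UNIV \<times> UNIV"
    by (rule Infinite_Sum.abs_summable_summable)
  from infsum_swap_banach[OF this]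
  have "(\<Sum>\<^sub>\<infinity>l. \<Sum>\<^sub>\<infinity>m. u l * (B l m * v m)) = (\<Sum>\<^sub>\<infinity>m. \<Sum>\<^sub>\<infinity>l. (u l * B l m) * v m)"
    by (simp add: mult.assoc)
  then show ?thesis by (simp only: infsum_cmult_right' infsum_cmult_left')
qed

text \<open>The iterated absolute sum converges because the entrywise absolute values of
  \<open>B\<close> and \<open>D\<close> stay in the class, hence so does their product
  \<open>BD\<close>, and \<open>A\<close> can be multiplied with it.\<close>

lemma matrix_mult_assoc:
  fixes A B D :: "('d::finite) lmatrix"
  assumes "A \<in> classB" "B \<in> classB" "D \<in> classB"
  shows "(\<Sum>\<^sub>\<infinity>m. (\<Sum>\<^sub>\<infinity>l. A i l * B l m) * D m j) = (\<Sum>\<^sub>\<infinity>l. A i l * (\<Sum>\<^sub>\<infinity>m. B l m * D m j))"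
proof (rule infsum_mult_assoc)
  show inner: "(\<lambda>m. cmod (B l m * D m j)) summable_on UNIV" for l j
    using assms by (intro matrix_prod_abs_summable)
  define BD :: "'d lmatrix" where
    "BD l j = (\<Sum>\<^sub>\<infinity>m. complex_of_real (cmod (B l m)) * complex_of_real (cmod (D m j)))" for l j
  have BD: "BD l j = complex_of_real (\<Sum>\<^sub>\<infinity>m. cmod (B l m * D m j))" for l
    using infsumI[OF has_sum_of_real[OF has_sum_infsum[OF inner[of l j]]]]
    by (simp add: BD_def norm_mult)
  have "BD \<in> classB"
    unfolding BD_def by (intro classB_mult) (simp_all add: classB_cmod assms)
  from matrix_prod_abs_summable[OF assms(1) this, of i j]
  show "(\<lambda>l. cmod (A i l) * (\<Sum>\<^sub>\<infinity>m. cmod (B l m * D m j))) summable_on UNIV"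
    by (simp add: BD norm_mult infsum_nonneg)
qed

text \<open>As for three matrices, with the sequence of absolute values of \<open>c\<close> in place
  of the third one; \<open>Bc\<close> is again in the weighted space.\<close>

lemma matrix_action_assoc:
  fixes w :: "int ^ 'd::finite \<Rightarrow> real"
  assumes q: "1 \<le> q" and w: "discrete_weight q w"
    and "A \<in> classB" "B \<in> classB" "c \<in> lq_space q w"
  shows "(\<Sum>\<^sub>\<infinity>m. (\<Sum>\<^sub>\<infinity>l. A i l * B l m) * c m) = (\<Sum>\<^sub>\<infinity>l. A i l * (\<Sum>\<^sub>\<infinity>m. B l m * c m))"
proof (rule infsum_mult_assoc)
  show inner: "(\<lambda>m. cmod (B l m * c m)) summable_on UNIV" for l
    using assms by (intro matrix_action_abs_summable)
  define Bc :: "'d lseq" where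
    "Bc l = (\<Sum>\<^sub>\<infinity>m. complex_of_real (cmod (B l m)) * complex_of_real (cmod (c m)))" for l
  have Bc: "Bc l = complex_of_real (\<Sum>\<^sub>\<infinity>m. cmod (B l m * c m))" for l
    using infsumI[OF has_sum_of_real[OF has_sum_infsum[OF inner[of l]]]]
    by (simp add: Bc_def norm_mult)
  have "Bc \<in> lq_space q w"
    unfolding Bc_def
    by (intro matrix_action_in_lq_space[OF q w]) (simp_all add: classB_cmod lq_space_cmod[OF q w] assms)
  from matrix_action_abs_summable[OF q w assms(3) this, of i]
  show "(\<lambda>l. cmod (A i l) * (\<Sum>\<^sub>\<infinity>m. cmod (B l m * c m))) summable_on UNIV"
    by (simp add: Bc norm_mult infsum_nonneg)
qed

section \<open>Unital algebras and the regular norm\<close>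

lemma cring_complex_ring: "cring complex_ring"
  by (rule cringI[OF abelian_groupI comm_monoidI])
    (auto simp: complex_ring_def algebra_simps intro: exI[of _ "- x" for x])

text \<open>Additive inverses are supplied by the scalar -1, so the axioms need no separate
  negation.\<close>

lemma unital_algebraI:
  fixes M (structure)
  assumes "\<And>x y. x \<in> carrier M \<Longrightarrow> y \<in> carrier M \<Longrightarrow> x \<oplus> y \<in> carrier M"
    and "\<zero> \<in> carrier M"
    and "\<And>x y z. x \<in> carrier M \<Longrightarrow> y \<in> carrier M \<Longrightarrow> z \<in> carrier M \<Longrightarrow> (x \<oplus> y) \<oplus> z = x \<oplus> (y \<oplus> z)"
    and "\<And>x y. x \<in> carrier M \<Longrightarrow> y \<in> carrier M \<Longrightarrow> x \<oplus> y = y \<oplus> x"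
    and "\<And>x. x \<in> carrier M \<Longrightarrow> \<zero> \<oplus> x = x"
    and "\<And>x. x \<in> carrier M \<Longrightarrow> (- 1) \<odot> x \<oplus> x = \<zero>"
    and "\<And>x y. x \<in> carrier M \<Longrightarrow> y \<in> carrier M \<Longrightarrow> x \<otimes> y \<in> carrier M"
    and "\<one> \<in> carrier M"
    and "\<And>x y z. x \<in> carrier M \<Longrightarrow> y \<in> carrier M \<Longrightarrow> z \<in> carrier M \<Longrightarrow> (x \<otimes> y) \<otimes> z = x \<otimes> (y \<otimes> z)"
    and "\<And>x. x \<in> carrier M \<Longrightarrow> \<one> \<otimes> x = x"
    and "\<And>x. x \<in> carrier M \<Longrightarrow> x \<otimes> \<one> = x"
    and "\<And>x y z. x \<in> carrier M \<Longrightarrow> y \<in> carrier M \<Longrightarrow> z \<in> carrier M \<Longrightarrow> (x \<oplus> y) \<otimes> z = x \<otimes> z \<oplus> y \<otimes> z"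
    and "\<And>x y z. x \<in> carrier M \<Longrightarrow> y \<in> carrier M \<Longrightarrow> z \<in> carrier M \<Longrightarrow> z \<otimes> (x \<oplus> y) = z \<otimes> x \<oplus> z \<otimes> y"
    and "\<And>\<alpha> x. x \<in> carrier M \<Longrightarrow> \<alpha> \<odot> x \<in> carrier M"
    and "\<And>\<alpha> \<beta> x. x \<in> carrier M \<Longrightarrow> (\<alpha> + \<beta>) \<odot> x = \<alpha> \<odot> x \<oplus> \<beta> \<odot> x"
    and "\<And>\<alpha> x y. x \<in> carrier M \<Longrightarrow> y \<in> carrier M \<Longrightarrow> \<alpha> \<odot> (x \<oplus> y) = \<alpha> \<odot> x \<oplus> \<alpha> \<odot> y"
    and "\<And>\<alpha> \<beta> x. x \<in> carrier M \<Longrightarrow> (\<alpha> * \<beta>) \<odot> x = \<alpha> \<odot> (\<beta> \<odot> x)"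
    and "\<And>x. x \<in> carrier M \<Longrightarrow> 1 \<odot> x = x"
    and "\<And>\<alpha> x y. x \<in> carrier M \<Longrightarrow> y \<in> carrier M \<Longrightarrow> (\<alpha> \<odot> x) \<otimes> y = \<alpha> \<odot> (x \<otimes> y)"
    and "\<And>\<alpha> x y. x \<in> carrier M \<Longrightarrow> y \<in> carrier M \<Longrightarrow> x \<otimes> (\<alpha> \<odot> y) = \<alpha> \<odot> (x \<otimes> y)"
  shows "unital_algebra M"
proof -
  have ab: "abelian_group M"
    using assms(14)[of _ "- 1"] assms(6)
    by (intro abelian_groupI assms(1-5)) blast+
  have "Ring.ring M"
    by (intro ringI ab monoidI assms)
  moreover have "Module.module complex_ring M"
    by (intro moduleI cring_complex_ring ab) (auto simp: complex_ring_def assms)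
  ultimately show ?thesis by (simp add: unital_algebra_def assms)
qed

section \<open>The regular norm of an algebra whose norm is submultiplicative up to a
  constant\<close>

context
  fixes M :: "(complex, 'a) module" (structure) and \<nu> :: "'a \<Rightarrow> real" and C :: real
  assumes alg: "unital_algebra M" and complete: "complete_norm M \<nu>" and one: "\<nu> \<one> = 1"
    and mult: "\<And>x y. x \<in> carrier M \<Longrightarrow> y \<in> carrier M \<Longrightarrow> \<nu> (x \<otimes> y) \<le> C * \<nu> x * \<nu> y"
begin

interpretation rg: Ring.ring M using alg by (simp add: unital_algebra_def)
interpretation md: Module.module complex_ring M using alg by (simp add: unital_algebra_def)

lemma smult_in_carrier: "x \<in> carrier M \<Longrightarrow> \<alpha> \<odot> x \<in> carrier M"
  by (rule md.smult_closed) (simp_all add: complex_ring_def)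

lemma smult_mult_left:
  "x \<in> carrier M \<Longrightarrow> y \<in> carrier M \<Longrightarrow> (\<alpha> \<odot> x) \<otimes> y = \<alpha> \<odot> (x \<otimes> y)"
  using alg by (simp add: unital_algebra_def)

lemma smult_mult_right:
  "x \<in> carrier M \<Longrightarrow> y \<in> carrier M \<Longrightarrow> x \<otimes> (\<alpha> \<odot> y) = \<alpha> \<odot> (x \<otimes> y)"
  using alg by (simp add: unital_algebra_def)

lemma
  assumes "x \<in> carrier M"
  shows nu_nonneg: "0 \<le> \<nu> x" and nu_eq_0: "\<nu> x = 0 \<longleftrightarrow> x = \<zero>"
    and nu_smult: "\<nu> (\<alpha> \<odot> x) = cmod \<alpha> * \<nu> x"
  using complete assms by (simp_all add: complete_norm_def is_norm_def)

lemma nu_add: "x \<in> carrier M \<Longrightarrow> y \<in> carrier M \<Longrightarrow> \<nu> (x \<oplus> y) \<le> \<nu> x + \<nu> y"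
  using complete by (simp add: complete_norm_def is_norm_def)

lemma C_ge_1: "1 \<le> C"
  using mult[of \<one> \<one>] one by simp

text \<open>The supremum is over a nonempty set because the unit has norm 1.\<close>

lemma regular_norm_least:
  assumes "\<And>y. y \<in> carrier M \<Longrightarrow> \<nu> y = 1 \<Longrightarrow> \<nu> (x \<otimes> y) \<le> b"
  shows "regular_norm M \<nu> x \<le> b"
  unfolding regular_norm_def
proof (rule cSUP_least)
  show "{y \<in> carrier M. \<nu> y = 1} \<noteq> {}" using one by blast
qed (use assms in auto)

text \<open>The supremum is a genuine one: \<open>C * \<nu> x\<close> bounds all its terms.\<close>

lemma regular_norm_upper:
  assumes "x \<in> carrier M" "y \<in> carrier M" "\<nu> y = 1"
  shows "\<nu> (x \<otimes> y) \<le> regular_norm M \<nu> x"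
  unfolding regular_norm_def
proof (rule cSUP_upper)
  show "bdd_above ((\<lambda>y. \<nu> (x \<otimes> y)) ` {y \<in> carrier M. \<nu> y = 1})"
    using mult[OF assms(1)] by (intro bdd_aboveI2[where M = "C * \<nu> x"]) fastforce
qed (use assms in simp)

text \<open>Nonzero \<open>y\<close> is rescaled to norm 1; a \<open>y\<close> of norm 0 is
  zero.\<close>

lemma norm_mult_le_regular_norm:
  assumes x: "x \<in> carrier M" and y: "y \<in> carrier M"
  shows "\<nu> (x \<otimes> y) \<le> regular_norm M \<nu> x * \<nu> y"
proof (cases "\<nu> y = 0")
  case True
  then have "y = \<zero>" using nu_eq_0[OF y] by simp
  then show ?thesis using x nu_eq_0[of \<zero>] by simp
next
  case False
  then have p: "0 < \<nu> y" using nu_nonneg[OF y] by simp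
  let ?a = "complex_of_real (1 / \<nu> y)"
  have "\<nu> (x \<otimes> (?a \<odot> y)) \<le> regular_norm M \<nu> x"
    using p by (intro regular_norm_upper x smult_in_carrier y) (simp add: nu_smult y norm_divide)
  moreover have "\<nu> (x \<otimes> (?a \<odot> y)) = \<nu> (x \<otimes> y) / \<nu> y"
    using p x y by (simp add: smult_mult_right nu_smult norm_divide)
  ultimately show ?thesis using p by (simp add: pos_divide_le_eq)
qed

lemma norm_le_regular_norm: "x \<in> carrier M \<Longrightarrow> \<nu> x \<le> regular_norm M \<nu> x"
  using regular_norm_upper[of x \<one>] one by simp

lemma regular_norm_le: "x \<in> carrier M \<Longrightarrow> regular_norm M \<nu> x \<le> C * \<nu> x"
  using mult[of x] by (intro regular_norm_least) force

lemma equivalent_norms_regular_norm: "equivalent_norms M \<nu> (regular_norm M \<nu>)"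
  unfolding equivalent_norms_def
  using C_ge_1 by (intro exI[of _ 1] exI[of _ C] conjI)
    (auto simp: norm_le_regular_norm regular_norm_le)

lemma regular_norm_nonneg: "x \<in> carrier M \<Longrightarrow> 0 \<le> regular_norm M \<nu> x"
  using nu_nonneg norm_le_regular_norm order_trans by blast

lemma is_norm_regular_norm: "is_norm M (regular_norm M \<nu>)"
  unfolding is_norm_def
proof (intro conjI ballI allI)
  fix x assume x: "x \<in> carrier M"
  show "0 \<le> regular_norm M \<nu> x" by (rule regular_norm_nonneg[OF x])
  have "regular_norm M \<nu> \<zero> \<le> 0"
    using regular_norm_le[of \<zero>] nu_eq_0[of \<zero>] by simp
  then show "regular_norm M \<nu> x = 0 \<longleftrightarrow> x = \<zero>"
    using regular_norm_nonneg[of \<zero>] norm_le_regular_norm[OF x] nu_nonneg[OF x] nu_eq_0[OF x]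
    by auto
  fix \<alpha>
  have "regular_norm M \<nu> (\<alpha> \<odot> x) \<le> cmod \<alpha> * regular_norm M \<nu> x"
    by (intro regular_norm_least)
      (simp add: smult_mult_left nu_smult x mult_left_mono regular_norm_upper)
  moreover have "cmod \<alpha> * regular_norm M \<nu> x \<le> regular_norm M \<nu> (\<alpha> \<odot> x)"
  proof (cases "\<alpha> = 0")
    case True
    then show ?thesis using regular_norm_nonneg[OF smult_in_carrier[OF x]] by simp
  next
    case False
    have "regular_norm M \<nu> x \<le> regular_norm M \<nu> (\<alpha> \<odot> x) / cmod \<alpha>"
    proof (rule regular_norm_least)
      fix y assume y: "y \<in> carrier M" "\<nu> y = 1"
      have "\<nu> ((\<alpha> \<odot> x) \<otimes> y) \<le> regular_norm M \<nu> (\<alpha> \<odot> x)"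
        by (intro regular_norm_upper smult_in_carrier x y)
      then show "\<nu> (x \<otimes> y) \<le> regular_norm M \<nu> (\<alpha> \<odot> x) / cmod \<alpha>"
        using False x y by (simp add: smult_mult_left nu_smult field_simps)
    qed
    then show ?thesis using False by (simp add: field_simps)
  qed
  ultimately show "regular_norm M \<nu> (\<alpha> \<odot> x) = cmod \<alpha> * regular_norm M \<nu> x" by simp
next
  fix x y assume x: "x \<in> carrier M" and y: "y \<in> carrier M"
  show "regular_norm M \<nu> (x \<oplus> y) \<le> regular_norm M \<nu> x + regular_norm M \<nu> y"
  proof (rule regular_norm_least)
    fix z assume z: "z \<in> carrier M" "\<nu> z = 1"
    have "\<nu> ((x \<oplus> y) \<otimes> z) \<le> \<nu> (x \<otimes> z) + \<nu> (y \<otimes> z)"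
      using x y z by (simp add: rg.l_distr nu_add)
    also have "\<dots> \<le> regular_norm M \<nu> x + regular_norm M \<nu> y"
      by (intro add_mono regular_norm_upper x y z)
    finally show "\<nu> ((x \<oplus> y) \<otimes> z) \<le> regular_norm M \<nu> x + regular_norm M \<nu> y" .
  qed
qed

text \<open>The lower norm comparison carries the Cauchy property over to \<nu>, and the upper one
  carries the limit back.\<close>

lemma complete_norm_regular_norm: "complete_norm M (regular_norm M \<nu>)"
  unfolding complete_norm_def
proof (intro conjI is_norm_regular_norm allI impI)
  fix X :: "nat \<Rightarrow> 'a"
  assume X: "range X \<subseteq> carrier M"
    and Cauchy: "\<forall>\<epsilon>>0. \<exists>N. \<forall>m\<ge>N. \<forall>n\<ge>N. regular_norm M \<nu> (X m \<ominus> X n) < \<epsilon>"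
  have Xc: "X n \<in> carrier M" for n using X by auto
  have "\<forall>\<epsilon>>0. \<exists>N. \<forall>m\<ge>N. \<forall>n\<ge>N. \<nu> (X m \<ominus> X n) < \<epsilon>"
    using Cauchy le_less_trans[OF norm_le_regular_norm[OF rg.minus_closed[OF Xc Xc]]] by meson
  then obtain x where x: "x \<in> carrier M" "(\<lambda>n. \<nu> (X n \<ominus> x)) \<longlonglongrightarrow> 0"
    using complete X unfolding complete_norm_def by meson
  have "(\<lambda>n. regular_norm M \<nu> (X n \<ominus> x)) \<longlonglongrightarrow> 0"
  proof (rule tendsto_sandwich[where f = "\<lambda>_. 0" and h = "\<lambda>n. C * \<nu> (X n \<ominus> x)"])
    show "(\<lambda>n. C * \<nu> (X n \<ominus> x)) \<longlonglongrightarrow> 0"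
      using tendsto_mult_left[OF x(2), of C] by simp
  qed (auto simp: regular_norm_nonneg regular_norm_le Xc x)
  with x(1) show "\<exists>x\<in>carrier M. (\<lambda>n. regular_norm M \<nu> (X n \<ominus> x)) \<longlonglongrightarrow> 0" by blast
qed

text \<open>The regular norm is the operator norm of left multiplication; by associativity the
  product of two elements acts as a composition, so the constant becomes 1.\<close>

lemma unital_banach_algebra_regular_norm: "unital_banach_algebra M (regular_norm M \<nu>)"
  unfolding unital_banach_algebra_def
proof (intro conjI alg complete_norm_regular_norm ballI)
  have "regular_norm M \<nu> \<one> \<le> 1" by (intro regular_norm_least) simp
  then show "regular_norm M \<nu> \<one> = 1" using norm_le_regular_norm[of \<one>] one by simp
next
  fix x y assume x: "x \<in> carrier M" and y: "y \<in> carrier M"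
  show "regular_norm M \<nu> (x \<otimes> y) \<le> regular_norm M \<nu> x * regular_norm M \<nu> y"
  proof (rule regular_norm_least)
    fix z assume z: "z \<in> carrier M" "\<nu> z = 1"
    have "\<nu> ((x \<otimes> y) \<otimes> z) = \<nu> (x \<otimes> (y \<otimes> z))" using x y z by (simp add: rg.m_assoc)
    also have "\<dots> \<le> regular_norm M \<nu> x * \<nu> (y \<otimes> z)"
      using x y z by (intro norm_mult_le_regular_norm) auto
    also have "\<dots> \<le> regular_norm M \<nu> x * regular_norm M \<nu> y"
      by (intro mult_left_mono regular_norm_upper regular_norm_nonneg x y z)
    finally show "\<nu> ((x \<otimes> y) \<otimes> z) \<le> regular_norm M \<nu> x * regular_norm M \<nu> y" .
  qed
qed

end

section \<open>The two algebras\<close>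

lemma matrix_algebra_simps [simp]:
  "carrier matrix_algebra = classB"
  "mult matrix_algebra A B = (\<lambda>i j. \<Sum>\<^sub>\<infinity>l. A i l * B l j)"
  "one matrix_algebra = (\<lambda>i j. if i = j then 1 else 0)"
  "zero matrix_algebra = (\<lambda>i j. 0)"
  "add matrix_algebra A B = (\<lambda>i j. A i j + B i j)"
  "smult matrix_algebra \<alpha> A = (\<lambda>i j. \<alpha> * A i j)"
  by (simp_all add: matrix_algebra_def)

lemma infsum_eq_single:
  fixes f :: "'a \<Rightarrow> complex"
  assumes "\<And>l. l \<noteq> i \<Longrightarrow> f l = 0"
  shows "(\<Sum>\<^sub>\<infinity>l. f l) = f i"
  using infsum_cong_neutral[of "{i}" UNIV f f] assms by auto

lemma infsum_delta_left: "(\<Sum>\<^sub>\<infinity>l. (if i = l then 1 else 0) * f l) = f i" for f :: "'a \<Rightarrow> complex"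
  by (subst infsum_eq_single[of i]) auto

lemma infsum_delta_right: "(\<Sum>\<^sub>\<infinity>l. f l * (if l = j then 1 else 0)) = f j" for f :: "'a \<Rightarrow> complex"
  by (subst infsum_eq_single[of j]) auto

lemma matrix_prod_summable:
  "A \<in> classB \<Longrightarrow> B \<in> classB \<Longrightarrow> (\<lambda>l. A i l * B l j) summable_on UNIV"
  by (rule Infinite_Sum.abs_summable_summable) (rule matrix_prod_abs_summable)

lemma unital_algebra_matrix_algebra:
  "unital_algebra (matrix_algebra :: (complex, ('d::finite) lmatrix) module)"
proof -
  have "(\<Sum>\<^sub>\<infinity>l. A i l * (\<alpha> * B l j)) = \<alpha> * (\<Sum>\<^sub>\<infinity>l. A i l * B l j)"
    for \<alpha> and A B :: "'d lmatrix" and i j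
    by (simp only: mult.left_commute[of _ \<alpha>] infsum_cmult_right')
  then show ?thesis
    by (intro unital_algebraI)
      (simp_all add: classB_add classB_zero classB_mult classB_one classB_smult matrix_mult_assoc
        infsum_delta_left infsum_delta_right add_ac distrib_left distrib_right mult.assoc
        matrix_prod_summable infsum_add infsum_cmult_right')
qed

text \<open>Identifies the abstract subtraction in \<open>complete_norm\<close> with the entrywise
  difference of \<open>classB_complete\<close>.\<close>

lemma matrix_algebra_minus:
  fixes A B :: "('d::finite) lmatrix"
  assumes "A \<in> classB" "B \<in> classB"
  shows "A \<ominus>\<^bsub>matrix_algebra\<^esub> B = (\<lambda>i j. A i j - B i j)"
proof -
  interpret Ring.ring "matrix_algebra :: (complex, 'd lmatrix) module"
    using unital_algebra_matrix_algebra unfolding unital_algebra_def by blast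
  have "\<ominus>\<^bsub>matrix_algebra\<^esub> B = (\<lambda>i j. - B i j)"
    using classB_smult[OF assms(2), of "- 1"] assms(2) by (intro minus_equality) auto
  then show ?thesis by (simp add: a_minus_def)
qed

lemma complete_norm_normB: "complete_norm matrix_algebra (normB :: ('d::finite) lmatrix \<Rightarrow> real)"
  unfolding complete_norm_def
proof (intro conjI allI impI)
  show "is_norm matrix_algebra (normB :: 'd lmatrix \<Rightarrow> real)"
    by (simp add: is_norm_def normB_nonneg normB_eq_0_iff normB_smult normB_add)
next
  fix X :: "nat \<Rightarrow> 'd lmatrix"
  assume "range X \<subseteq> carrier matrix_algebra"
    and Cauchy: "\<forall>\<epsilon>>0. \<exists>N. \<forall>m\<ge>N. \<forall>n\<ge>N. normB (X m \<ominus>\<^bsub>matrix_algebra\<^esub> X n) < \<epsilon>"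
  then have X: "X n \<in> classB" for n by auto
  have "\<exists>N. \<forall>m\<ge>N. \<forall>n\<ge>N. normB (\<lambda>i j. X m i j - X n i j) < \<epsilon>" if "0 < \<epsilon>" for \<epsilon>
    using Cauchy[rule_format, OF that] by (simp only: matrix_algebra_minus X)
  from classB_complete[OF X this] obtain Z
    where "Z \<in> classB" "(\<lambda>n. normB (\<lambda>i j. X n i j - Z i j)) \<longlonglongrightarrow> 0" by blast
  then show "\<exists>Z\<in>carrier matrix_algebra. (\<lambda>n. normB (X n \<ominus>\<^bsub>matrix_algebra\<^esub> Z)) \<longlonglongrightarrow> 0"
    by (auto simp: matrix_algebra_minus X)
qed

section \<open>The algebra of bounded operators on the weighted space\<close>

lemma operator_algebra_simps [simp]:
  "carrier (operator_algebra q w) = bounded_operators q w"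
  "mult (operator_algebra q w) = compose (lq_space q w)"
  "one (operator_algebra q w) = (\<lambda>c\<in>lq_space q w. c)"
  "zero (operator_algebra q w) = (\<lambda>c\<in>lq_space q w. \<lambda>i. 0)"
  "add (operator_algebra q w) S T = (\<lambda>c\<in>lq_space q w. \<lambda>i. S c i + T c i)"
  "smult (operator_algebra q w) \<alpha> T = (\<lambda>c\<in>lq_space q w. \<lambda>i. \<alpha> * T c i)"
  by (simp_all add: operator_algebra_def)

context
  fixes q :: real and w :: "int ^ 'd::finite \<Rightarrow> real"
  assumes q: "1 \<le> q" and w: "discrete_weight q w"
begin

lemma bounded_operators_iff:
  "T \<in> bounded_operators q w \<longleftrightarrow>
     T \<in> lq_space q w \<rightarrow>\<^sub>E lq_space q w \<and>
     (\<forall>c\<in>lq_space q w. \<forall>c'\<in>lq_space q w. T (\<lambda>i. c i + c' i) = (\<lambda>i. T c i + T c' i)) \<and>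
     (\<forall>\<alpha>. \<forall>c\<in>lq_space q w. T (\<lambda>i. \<alpha> * c i) = (\<lambda>i. \<alpha> * T c i)) \<and>
     (\<exists>K\<ge>0. \<forall>c\<in>lq_space q w. lq_mass q w (T c) \<le> K * lq_mass q w c)"
  unfolding bounded_operators_def mem_Collect_eq lq_norm_bound_iff[OF q w] by simp

lemma bounded_operatorI:
  assumes "\<And>c. c \<in> lq_space q w \<Longrightarrow> T c \<in> lq_space q w"
    and "\<And>c c'. c \<in> lq_space q w \<Longrightarrow> c' \<in> lq_space q w \<Longrightarrow> T (\<lambda>i. c i + c' i) = (\<lambda>i. T c i + T c' i)"
    and "\<And>\<alpha> c. c \<in> lq_space q w \<Longrightarrow> T (\<lambda>i. \<alpha> * c i) = (\<lambda>i. \<alpha> * T c i)"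
    and "0 \<le> K" "\<And>c. c \<in> lq_space q w \<Longrightarrow> lq_mass q w (T c) \<le> K * lq_mass q w c"
  shows "(\<lambda>c\<in>lq_space q w. T c) \<in> bounded_operators q w"
  unfolding bounded_operators_iff
  using assms by (auto simp: lq_space_add[OF q w] lq_space_scale[OF q w] intro!: exI[of _ K])

lemma
  assumes T: "T \<in> bounded_operators q w"
  shows bounded_operator_closed: "c \<in> lq_space q w \<Longrightarrow> T c \<in> lq_space q w"
    and bounded_operator_extensional: "T \<in> extensional (lq_space q w)"
    and bounded_operator_add:
      "c \<in> lq_space q w \<Longrightarrow> c' \<in> lq_space q w \<Longrightarrow> T (\<lambda>i. c i + c' i) = (\<lambda>i. T c i + T c' i)"
    and bounded_operator_scale: "c \<in> lq_space q w \<Longrightarrow> T (\<lambda>i. \<alpha> * c i) = (\<lambda>i. \<alpha> * T c i)"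
    and bounded_operator_bound: "\<exists>K\<ge>0. \<forall>c\<in>lq_space q w. lq_mass q w (T c) \<le> K * lq_mass q w c"
  using T unfolding bounded_operators_iff PiE_iff by simp_all

lemma bounded_operators_zero: "(\<lambda>c\<in>lq_space q w. \<lambda>i. 0) \<in> bounded_operators q w"
  by (rule bounded_operatorI[where K = 0]) (simp_all add: lq_space_zero[OF q w] lq_mass_def)

lemma bounded_operators_id: "(\<lambda>c\<in>lq_space q w. c) \<in> bounded_operators q w"
  by (rule bounded_operatorI[where K = 1]) simp_all

lemma bounded_operators_add:
  assumes S: "S \<in> bounded_operators q w" and T: "T \<in> bounded_operators q w"
  shows "(\<lambda>c\<in>lq_space q w. \<lambda>i. S c i + T c i) \<in> bounded_operators q w"
proof -
  obtain K where K: "0 \<le> K" "\<And>c. c \<in> lq_space q w \<Longrightarrow> lq_mass q w (S c) \<le> K * lq_mass q w c"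
    using bounded_operator_bound[OF S] by blast
  obtain L where L: "0 \<le> L" "\<And>c. c \<in> lq_space q w \<Longrightarrow> lq_mass q w (T c) \<le> L * lq_mass q w c"
    using bounded_operator_bound[OF T] by blast
  show ?thesis
  \<comment> \<open>The factor \<open>2 powr q\<close> is the constant of
    \<open>lq_mass_add\<close>.\<close>
  proof (rule bounded_operatorI[where K = "2 powr q * (K + L)"])
    fix c assume c: "c \<in> lq_space q w"
    have "lq_mass q w (\<lambda>i. S c i + T c i) \<le> 2 powr q * (lq_mass q w (S c) + lq_mass q w (T c))"
      by (rule lq_mass_add[OF q w bounded_operator_closed[OF S c] bounded_operator_closed[OF T c]])
    also have "\<dots> \<le> 2 powr q * (K * lq_mass q w c + L * lq_mass q w c)"
      by (intro mult_left_mono add_mono K L c) simp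
    finally show "lq_mass q w (\<lambda>i. S c i + T c i) \<le> 2 powr q * (K + L) * lq_mass q w c"
      by (simp add: algebra_simps)
  qed (simp_all add: K L lq_space_add[OF q w] bounded_operator_closed[OF S] bounded_operator_closed[OF T]
      bounded_operator_add[OF S] bounded_operator_add[OF T]
      bounded_operator_scale[OF S] bounded_operator_scale[OF T] add_ac distrib_left)
qed

lemma bounded_operators_scale:
  assumes T: "T \<in> bounded_operators q w"
  shows "(\<lambda>c\<in>lq_space q w. \<lambda>i. \<alpha> * T c i) \<in> bounded_operators q w"
proof -
  obtain K where K: "0 \<le> K" "\<And>c. c \<in> lq_space q w \<Longrightarrow> lq_mass q w (T c) \<le> K * lq_mass q w c"
    using bounded_operator_bound[OF T] by blast
  show ?thesis
  proof (rule bounded_operatorI[where K = "cmod \<alpha> powr q * K"])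
    fix c assume "c \<in> lq_space q w"
    then show "lq_mass q w (\<lambda>i. \<alpha> * T c i) \<le> cmod \<alpha> powr q * K * lq_mass q w c"
      by (simp add: lq_mass_scale[OF q w] mult.assoc mult_left_mono K)
  qed (simp_all add: K lq_space_scale[OF q w] bounded_operator_closed[OF T]
      bounded_operator_add[OF T] bounded_operator_scale[OF T] distrib_left mult.left_commute)
qed

lemma bounded_operators_compose:
  assumes S: "S \<in> bounded_operators q w" and T: "T \<in> bounded_operators q w"
  shows "compose (lq_space q w) S T \<in> bounded_operators q w"
proof -
  obtain K where K: "0 \<le> K" "\<And>c. c \<in> lq_space q w \<Longrightarrow> lq_mass q w (S c) \<le> K * lq_mass q w c"
    using bounded_operator_bound[OF S] by blast
  obtain L where L: "0 \<le> L" "\<And>c. c \<in> lq_space q w \<Longrightarrow> lq_mass q w (T c) \<le> L * lq_mass q w c"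
    using bounded_operator_bound[OF T] by blast
  show ?thesis
    unfolding compose_def
  proof (rule bounded_operatorI[where K = "K * L"])
    fix c assume c: "c \<in> lq_space q w"
    have "lq_mass q w (S (T c)) \<le> K * lq_mass q w (T c)"
      by (intro K bounded_operator_closed[OF T] c)
    also have "\<dots> \<le> K * (L * lq_mass q w c)"
      by (intro mult_left_mono K L c)
    finally show "lq_mass q w (S (T c)) \<le> K * L * lq_mass q w c" by (simp add: mult.assoc)
  qed (use K L in \<open>auto simp: bounded_operator_closed[OF S] bounded_operator_closed[OF T]
        bounded_operator_add[OF S] bounded_operator_add[OF T]
        bounded_operator_scale[OF S] bounded_operator_scale[OF T]\<close>)
qed

text \<open>Operators have a fixed value outside the space, so comparing coordinates of images of
  sequences in the space is enough.\<close>

lemma bounded_operator_eqI: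
  assumes "S \<in> extensional (lq_space q w)" "T \<in> extensional (lq_space q w)"
    and "\<And>c i. c \<in> lq_space q w \<Longrightarrow> S c i = T c i"
  shows "S = T"
  using assms by (intro extensionalityI[of S "lq_space q w"]) auto

lemma unital_algebra_operator_algebra: "unital_algebra (operator_algebra q w)"
proof (rule unital_algebraI; unfold operator_algebra_simps)
  let ?S = "lq_space q w" and ?B = "bounded_operators q w"
  show "(\<lambda>c\<in>?S. \<lambda>i. 0) \<in> ?B" by (rule bounded_operators_zero)
  show "(\<lambda>c\<in>?S. c) \<in> ?B" by (rule bounded_operators_id)
  fix R assume R: "R \<in> ?B"
  note ext = bounded_operator_extensional[OF R]
  show "(\<lambda>c\<in>?S. \<lambda>i. (\<lambda>c\<in>?S. \<lambda>i. 0) c i + R c i) = R"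
    by (rule bounded_operator_eqI) (simp_all add: ext)
  show "(\<lambda>c\<in>?S. \<lambda>i. (\<lambda>c\<in>?S. \<lambda>i. - 1 * R c i) c i + R c i) = (\<lambda>c\<in>?S. \<lambda>i. 0)"
    by (rule bounded_operator_eqI) simp_all
  show "compose ?S (\<lambda>c\<in>?S. c) R = R"
    by (rule bounded_operator_eqI) (simp_all add: compose_def bounded_operator_closed[OF R] ext)
  show "compose ?S R (\<lambda>c\<in>?S. c) = R"
    by (rule bounded_operator_eqI) (simp_all add: compose_def ext)
  show "(\<lambda>c\<in>?S. \<lambda>i. 1 * R c i) = R"
    by (rule bounded_operator_eqI) (simp_all add: ext)
  fix \<alpha>
  show "(\<lambda>c\<in>?S. \<lambda>i. \<alpha> * R c i) \<in> ?B" by (rule bounded_operators_scale[OF R])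
  show "(\<lambda>c\<in>?S. \<lambda>i. (\<alpha> + \<beta>) * R c i)
      = (\<lambda>c\<in>?S. \<lambda>i. (\<lambda>c\<in>?S. \<lambda>i. \<alpha> * R c i) c i + (\<lambda>c\<in>?S. \<lambda>i. \<beta> * R c i) c i)" for \<beta>
    by (rule bounded_operator_eqI) (simp_all add: distrib_right)
  show "(\<lambda>c\<in>?S. \<lambda>i. \<alpha> * \<beta> * R c i) = (\<lambda>c\<in>?S. \<lambda>i. \<alpha> * (\<lambda>c\<in>?S. \<lambda>i. \<beta> * R c i) c i)" for \<beta>
    by (rule bounded_operator_eqI) simp_all
  fix S assume S: "S \<in> ?B"
  show "(\<lambda>c\<in>?S. \<lambda>i. R c i + S c i) \<in> ?B" by (rule bounded_operators_add[OF R S])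
  show "compose ?S R S \<in> ?B" by (rule bounded_operators_compose[OF R S])
  show "(\<lambda>c\<in>?S. \<lambda>i. R c i + S c i) = (\<lambda>c\<in>?S. \<lambda>i. S c i + R c i)"
    by (simp only: add.commute)
  show "(\<lambda>c\<in>?S. \<lambda>i. \<alpha> * (\<lambda>c\<in>?S. \<lambda>i. R c i + S c i) c i)
      = (\<lambda>c\<in>?S. \<lambda>i. (\<lambda>c\<in>?S. \<lambda>i. \<alpha> * R c i) c i + (\<lambda>c\<in>?S. \<lambda>i. \<alpha> * S c i) c i)"
    by (rule bounded_operator_eqI) (simp_all add: distrib_left)
  note simps = compose_def bounded_operator_closed[OF R] bounded_operator_closed[OF S]
    bounded_operator_add[OF R] bounded_operator_scale[OF R]
  show "compose ?S R (\<lambda>c\<in>?S. \<lambda>i. \<alpha> * S c i) = (\<lambda>c\<in>?S. \<lambda>i. \<alpha> * compose ?S R S c i)"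
    by (rule bounded_operator_eqI) (simp_all add: simps)
  show "compose ?S (\<lambda>c\<in>?S. \<lambda>i. \<alpha> * R c i) S = (\<lambda>c\<in>?S. \<lambda>i. \<alpha> * compose ?S R S c i)"
    by (rule bounded_operator_eqI) (simp_all add: simps)
  fix T assume T: "T \<in> ?B"
  note simps = simps bounded_operator_closed[OF T]
  show "(\<lambda>c\<in>?S. \<lambda>i. (\<lambda>c\<in>?S. \<lambda>i. R c i + S c i) c i + T c i)
      = (\<lambda>c\<in>?S. \<lambda>i. R c i + (\<lambda>c\<in>?S. \<lambda>i. S c i + T c i) c i)"
    by (rule bounded_operator_eqI) (simp_all add: add.assoc)
  show "compose ?S (compose ?S R S) T = compose ?S R (compose ?S S T)"
    by (rule bounded_operator_eqI) (simp_all add: simps)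
  show "compose ?S (\<lambda>c\<in>?S. \<lambda>i. R c i + S c i) T
      = (\<lambda>c\<in>?S. \<lambda>i. compose ?S R T c i + compose ?S S T c i)"
    by (rule bounded_operator_eqI) (simp_all add: simps)
  show "compose ?S R (\<lambda>c\<in>?S. \<lambda>i. S c i + T c i)
      = (\<lambda>c\<in>?S. \<lambda>i. compose ?S R S c i + compose ?S R T c i)"
    by (rule bounded_operator_eqI) (simp_all add: simps)
qed

section \<open>Matrices as bounded operators\<close>

lemma matrix_operator_bounded:
  assumes A: "A \<in> classB"
  shows "matrix_operator q w A \<in> bounded_operators q w"
proof -
  obtain K where K: "0 \<le> K" "\<And>A c. A \<in> classB \<Longrightarrow> c \<in> lq_space q w \<Longrightarrow>
     lq_mass q w (\<lambda>i. \<Sum>\<^sub>\<infinity>j. A i j * c j) \<le> K * normB A powr q * lq_mass q w c"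
    using matrix_action_bounded[OF q w] by blast
  have s: "(\<lambda>j. A i j * c j) summable_on UNIV" if "c \<in> lq_space q w" for i c
    by (rule Infinite_Sum.abs_summable_summable) (rule matrix_action_abs_summable[OF q w A that])
  show ?thesis
    unfolding matrix_operator_def
  proof (rule bounded_operatorI[where K = "K * normB A powr q"])
    fix c c' assume c: "c \<in> lq_space q w" and c': "c' \<in> lq_space q w"
    show "(\<lambda>i. \<Sum>\<^sub>\<infinity>j. A i j * (c j + c' j)) = (\<lambda>i. (\<Sum>\<^sub>\<infinity>j. A i j * c j) + (\<Sum>\<^sub>\<infinity>j. A i j * c' j))"
      by (simp add: distrib_left infsum_add s c c')
  next
    fix \<alpha> c assume c: "c \<in> lq_space q w"
    have "A i j * (\<alpha> * c j) = \<alpha> * (A i j * c j)" for i j by simp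
    then show "(\<lambda>i. \<Sum>\<^sub>\<infinity>j. A i j * (\<alpha> * c j)) = (\<lambda>i. \<alpha> * (\<Sum>\<^sub>\<infinity>j. A i j * c j))"
      by (simp only: infsum_cmult_right')
  qed (use K A in \<open>auto intro!: matrix_action_in_lq_space[OF q w]\<close>)
qed

text \<open>Multiplicativity is the exchange of sums in \<open>matrix_action_assoc\<close>,
  additivity follows from convergence of the rows, and injectivity from testing on unit
  sequences.\<close>

lemma algebra_embedding_matrix_operator:
  "algebra_embedding matrix_algebra (operator_algebra q w) (matrix_operator q w)"
proof -
  have s: "(\<lambda>j. A i j * c j) summable_on UNIV" if "A \<in> classB" "c \<in> lq_space q w" for A i c
    by (rule Infinite_Sum.abs_summable_summable) (rule matrix_action_abs_summable[OF q w that])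
  have "matrix_operator q w \<in> ring_hom matrix_algebra (operator_algebra q w)"
  proof (rule ring_hom_memI)
    fix A B :: "'d lmatrix" assume "A \<in> carrier matrix_algebra" "B \<in> carrier matrix_algebra"
    then have A: "A \<in> classB" and B: "B \<in> classB" by simp_all
    show "matrix_operator q w (A \<otimes>\<^bsub>matrix_algebra\<^esub> B)
        = matrix_operator q w A \<otimes>\<^bsub>operator_algebra q w\<^esub> matrix_operator q w B"
      by (rule bounded_operator_eqI)
        (simp_all add: matrix_operator_def compose_def matrix_action_in_lq_space[OF q w B]
          matrix_action_assoc[OF q w A B])
    show "matrix_operator q w (A \<oplus>\<^bsub>matrix_algebra\<^esub> B)
        = matrix_operator q w A \<oplus>\<^bsub>operator_algebra q w\<^esub> matrix_operator q w B"
      by (rule bounded_operator_eqI)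
        (simp_all add: matrix_operator_def distrib_right infsum_add s A B)
  next
    show "matrix_operator q w \<one>\<^bsub>matrix_algebra\<^esub> = \<one>\<^bsub>operator_algebra q w\<^esub>"
      by (rule bounded_operator_eqI) (simp_all add: matrix_operator_def infsum_delta_left)
  qed (simp add: matrix_operator_bounded)
  moreover have "matrix_operator q w (\<alpha> \<odot>\<^bsub>matrix_algebra\<^esub> A)
      = \<alpha> \<odot>\<^bsub>operator_algebra q w\<^esub> matrix_operator q w A" for \<alpha> A
    by (rule bounded_operator_eqI) (simp_all add: matrix_operator_def mult.assoc infsum_cmult_right')
  moreover have "inj_on (matrix_operator q w) classB"
  proof (rule inj_onI)
    fix A B assume eq: "matrix_operator q w A = matrix_operator q w B"
    have "A i j = B i j" for i j
      using fun_cong[OF fun_cong[OF eq, of "\<lambda>i. if i = j then 1 else 0"], of i]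
      by (simp add: matrix_operator_def lq_space_unit[OF q w] infsum_delta_right)
    then show "A = B" by blast
  qed
  ultimately show ?thesis
    by (simp add: algebra_embedding_def unital_algebra_matrix_algebra unital_algebra_operator_algebra)
qed

end

text \<open>The two clauses on absolute summability certify that the infinite sums in the matrix
  product and in the action are genuine sums and not the default value 0 of a divergent
  \<open>infsum\<close>.\<close>

theorem theorem1p1:
  fixes q :: real and w :: "int ^ 'd \<Rightarrow> real"
  assumes "1 \<le> q" and "discrete_weight q w"
  shows
    "(\<forall>A\<in>(classB :: 'd lmatrix set). \<forall>B\<in>classB. \<forall>i j.
        (\<lambda>l. cmod (A i l * B l j)) summable_on UNIV) \<and>
     unital_algebra (matrix_algebra :: (complex, 'd lmatrix) module) \<and>
     complete_norm matrix_algebra (normB :: 'd lmatrix \<Rightarrow> real) \<and>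
     (\<exists>C. \<forall>A\<in>(classB :: 'd lmatrix set). \<forall>B\<in>classB.
        normB (A \<otimes>\<^bsub>matrix_algebra\<^esub> B) \<le> C * normB A * normB B) \<and>
     equivalent_norms matrix_algebra (normB :: 'd lmatrix \<Rightarrow> real)
        (regular_norm matrix_algebra normB) \<and>
     unital_banach_algebra (matrix_algebra :: (complex, 'd lmatrix) module)
        (regular_norm matrix_algebra normB) \<and>
     (\<forall>A\<in>(classB :: 'd lmatrix set). \<forall>c\<in>lq_space q w. \<forall>i.
        (\<lambda>j. cmod (A i j * c j)) summable_on UNIV) \<and>
     algebra_embedding matrix_algebra (operator_algebra q w) (matrix_operator q w)"
proof -
  have one: "normB \<one>\<^bsub>matrix_algebra :: (complex, 'd lmatrix) module\<^esub> = 1"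
    using normB_one by simp
  have mult: "normB (A \<otimes>\<^bsub>matrix_algebra\<^esub> B) \<le> 2 * 2 ^ CARD('d) * normB A * normB B"
    if "A \<in> carrier matrix_algebra" "B \<in> carrier matrix_algebra" for A B :: "'d lmatrix"
    using normB_mult that by simp
  \<comment> \<open>These are the hypotheses of the abstract treatment of the regular norm, with
    \<open>C\<close> equal to \<open>2 * 2 ^ CARD('d)\<close>.\<close>
  note regular = unital_algebra_matrix_algebra complete_norm_normB one mult
  show ?thesis
  proof (intro conjI ballI allI)
    show "\<exists>C. \<forall>A\<in>(classB :: 'd lmatrix set). \<forall>B\<in>classB.
        normB (A \<otimes>\<^bsub>matrix_algebra\<^esub> B) \<le> C * normB A * normB B"
      using mult by auto
    show "equivalent_norms matrix_algebra (normB :: 'd lmatrix \<Rightarrow> real) (regular_norm matrix_algebra normB)"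
      by (rule equivalent_norms_regular_norm[where \<nu> = normB, OF regular])
    show "unital_banach_algebra (matrix_algebra :: (complex, 'd lmatrix) module) (regular_norm matrix_algebra normB)"
      by (rule unital_banach_algebra_regular_norm[where \<nu> = normB, OF regular])
  qed (simp_all only: matrix_prod_abs_summable unital_algebra_matrix_algebra complete_norm_normB
      matrix_action_abs_summable[OF assms] algebra_embedding_matrix_operator[OF assms])
qed

end
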